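(* For every standard $k \in \mathbb{N}$, $\mathsf{CNS}$ implies $\mathsf{SRT}^2_k$ over $\mathsf{RCA}_0$; that is, $\mathsf{RCA}_0 + \mathsf{CNS} \vdash \mathsf{SRT}^2_k$.
   Context: $\mathsf{RCA}_0$ is the usual base system of reverse mathematics (second-order arithmetic with $\Delta^0_1$ comprehension and $\Sigma^0_1$ induction). $\mathsf{CNS}$ (computably bounded non-decreasing subsequence): "Every computably bounded $\Delta^0_2$ function admits an infinite non-decreasing subsequence." Formally: for every $f : \mathbb{N}\times\mathbb{N} \to \mathbb{N}$ such that $\tilde f(x) = \lim_s f(x,s)$ exists for every $x$, and every $b : \mathbb{N}\to\mathbb{N}$ such that $\tilde f(x) \leq b(x)$ for all $x$, there is an infinite set $X \subseteq \mathbb{N}$ such that $\tilde f(x) \leq \tilde f(y)$ for all $x<y$ in $X$. A coloring $f : [\mathbb{N}]^2 \to k$ (i.e. with colors $\{0,\dots,k-1\}$) is stable if $\lim_s f(x,s)$ exists for every $x \in \mathbb{N}$. A set $H$ is homogeneous for $f$ if $f$ is constant on $[H]^2$. $\mathsf{SRT}^2_k$ (stable Ramsey's theorem for pairs and $k$ colors): every stable coloring $f : [\mathbb{N}]^2 \to k$ has an infinite homogeneous set. *)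

theory Defs
  imports Main
begin

section \<open>The language of second-order arithmetic\<close>

text \<open>
  Variables are de Bruijn indices, with independent index spaces for number variables
  (bound by \<open>All1\<close>, \<open>Ex1\<close>) and set variables (bound by \<open>All2\<close>, \<open>Ex2\<close>).
  Equality is primitive for numbers only; sets are compared extensionally.
\<close>

datatype tm = Var nat | Zero | One | Add tm tm | Mul tm tm

datatype fm =
    Eq tm tm | Less tm tm | Mem tm nat | Falsum | Imp fm fm | All1 fm | All2 fm

notation Add (infixl "\<^bold>+" 65)
notation Mul (infixl "\<^bold>*" 70)
notation Eq (infix "\<^bold>=" 50)
notation Less (infix "\<^bold><" 50)
notation Mem (infix "\<^bold>\<in>" 50)
notation Imp (infixr "\<^bold>\<longrightarrow>" 25)

definition Neg :: "fm \<Rightarrow> fm" ("\<^bold>\<not> _" [40] 40)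
  where "(\<^bold>\<not> \<phi>) = (\<phi> \<^bold>\<longrightarrow> Falsum)"

definition And :: "fm \<Rightarrow> fm \<Rightarrow> fm" (infixr "\<^bold>\<and>" 35)
  where "(\<phi> \<^bold>\<and> \<psi>) = (\<^bold>\<not> (\<phi> \<^bold>\<longrightarrow> \<^bold>\<not> \<psi>))"

definition Or :: "fm \<Rightarrow> fm \<Rightarrow> fm" (infixr "\<^bold>\<or>" 30)
  where "(\<phi> \<^bold>\<or> \<psi>) = (\<^bold>\<not> \<phi> \<^bold>\<longrightarrow> \<psi>)"

definition Iff :: "fm \<Rightarrow> fm \<Rightarrow> fm" (infix "\<^bold>\<longleftrightarrow>" 25)
  where "(\<phi> \<^bold>\<longleftrightarrow> \<psi>) = ((\<phi> \<^bold>\<longrightarrow> \<psi>) \<^bold>\<and> (\<psi> \<^bold>\<longrightarrow> \<phi>))"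

definition Ex1 :: "fm \<Rightarrow> fm"
  where "Ex1 \<phi> = (\<^bold>\<not> All1 (\<^bold>\<not> \<phi>))"

definition Ex2 :: "fm \<Rightarrow> fm"
  where "Ex2 \<phi> = (\<^bold>\<not> All2 (\<^bold>\<not> \<phi>))"

definition Le :: "tm \<Rightarrow> tm \<Rightarrow> fm" (infix "\<^bold>\<le>" 50)
  where "(s \<^bold>\<le> t) = (s \<^bold>< t \<^bold>\<or> s \<^bold>= t)"

primrec numeral_tm :: "nat \<Rightarrow> tm" where
  "numeral_tm 0 = Zero"
| "numeral_tm (Suc n) = numeral_tm n \<^bold>+ One"


subsection \<open>Substitution\<close>

primrec subst_tm :: "(nat \<Rightarrow> tm) \<Rightarrow> tm \<Rightarrow> tm" where
  "subst_tm \<sigma> (Var i) = \<sigma> i"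
| "subst_tm \<sigma> Zero = Zero"
| "subst_tm \<sigma> One = One"
| "subst_tm \<sigma> (s \<^bold>+ t) = subst_tm \<sigma> s \<^bold>+ subst_tm \<sigma> t"
| "subst_tm \<sigma> (s \<^bold>* t) = subst_tm \<sigma> s \<^bold>* subst_tm \<sigma> t"

definition shift :: "tm \<Rightarrow> tm" ("\<up>_" [1000] 1000)
  where "\<up>t = subst_tm (\<lambda>i. Var (Suc i)) t"

text \<open>Simultaneous substitution of terms for number variables and renaming of set variables.\<close>

primrec subst :: "(nat \<Rightarrow> tm) \<Rightarrow> (nat \<Rightarrow> nat) \<Rightarrow> fm \<Rightarrow> fm" where
  "subst \<sigma> \<rho> (s \<^bold>= t) = (subst_tm \<sigma> s \<^bold>= subst_tm \<sigma> t)"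
| "subst \<sigma> \<rho> (s \<^bold>< t) = (subst_tm \<sigma> s \<^bold>< subst_tm \<sigma> t)"
| "subst \<sigma> \<rho> (t \<^bold>\<in> X) = (subst_tm \<sigma> t \<^bold>\<in> \<rho> X)"
| "subst \<sigma> \<rho> Falsum = Falsum"
| "subst \<sigma> \<rho> (\<phi> \<^bold>\<longrightarrow> \<psi>) = (subst \<sigma> \<rho> \<phi> \<^bold>\<longrightarrow> subst \<sigma> \<rho> \<psi>)"
| "subst \<sigma> \<rho> (All1 \<phi>) = All1 (subst (case_nat (Var 0) (\<lambda>i. \<up>(\<sigma> i))) \<rho> \<phi>)"
| "subst \<sigma> \<rho> (All2 \<phi>) = All2 (subst \<sigma> (case_nat 0 (\<lambda>i. Suc (\<rho> i))) \<phi>)"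

definition shift1 :: "fm \<Rightarrow> fm"
  where "shift1 \<phi> = subst (\<lambda>i. Var (Suc i)) id \<phi>"

definition shift2 :: "fm \<Rightarrow> fm"
  where "shift2 \<phi> = subst Var Suc \<phi>"

text \<open>
  \<open>inst1 t\<close> and \<open>inst2 X\<close> remove a quantifier: variable 0 is instantiated and all other
  free variables of that sort are decremented.
\<close>

definition inst1 :: "tm \<Rightarrow> fm \<Rightarrow> fm"
  where "inst1 t \<phi> = subst (case_nat t Var) id \<phi>"

definition inst2 :: "nat \<Rightarrow> fm \<Rightarrow> fm"
  where "inst2 X \<phi> = subst Var (case_nat X id) \<phi>"


subsection \<open>Provability\<close>

text \<open>
  Classical two-sorted natural deduction. Shifting the hypotheses in the two introduction
  rules for quantifiers is the eigenvariable condition. The hypotheses may form an infinite set;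
  a derivation uses only finitely many of them.
\<close>

inductive derives :: "fm set \<Rightarrow> fm \<Rightarrow> bool" (infix "\<turnstile>" 20) where
  Assumption: "\<phi> \<in> \<Gamma> \<Longrightarrow> \<Gamma> \<turnstile> \<phi>"
| Imp_intro: "insert \<phi> \<Gamma> \<turnstile> \<psi> \<Longrightarrow> \<Gamma> \<turnstile> \<phi> \<^bold>\<longrightarrow> \<psi>"
| Imp_elim: "\<Gamma> \<turnstile> \<phi> \<^bold>\<longrightarrow> \<psi> \<Longrightarrow> \<Gamma> \<turnstile> \<phi> \<Longrightarrow> \<Gamma> \<turnstile> \<psi>"
| Classical: "insert (\<^bold>\<not> \<phi>) \<Gamma> \<turnstile> Falsum \<Longrightarrow> \<Gamma> \<turnstile> \<phi>"
| All1_intro: "shift1 ` \<Gamma> \<turnstile> \<phi> \<Longrightarrow> \<Gamma> \<turnstile> All1 \<phi>"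
| All1_elim: "\<Gamma> \<turnstile> All1 \<phi> \<Longrightarrow> \<Gamma> \<turnstile> inst1 t \<phi>"
| All2_intro: "shift2 ` \<Gamma> \<turnstile> \<phi> \<Longrightarrow> \<Gamma> \<turnstile> All2 \<phi>"
| All2_elim: "\<Gamma> \<turnstile> All2 \<phi> \<Longrightarrow> \<Gamma> \<turnstile> inst2 X \<phi>"
| Eq_refl: "\<Gamma> \<turnstile> t \<^bold>= t"
| Eq_subst: "\<Gamma> \<turnstile> s \<^bold>= t \<Longrightarrow> \<Gamma> \<turnstile> inst1 s \<phi> \<Longrightarrow> \<Gamma> \<turnstile> inst1 t \<phi>"


subsection \<open>Universal closures\<close>

primrec closed_tm :: "nat \<Rightarrow> tm \<Rightarrow> bool" where
  "closed_tm m (Var i) = (i < m)"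
| "closed_tm m Zero = True"
| "closed_tm m One = True"
| "closed_tm m (s \<^bold>+ t) = (closed_tm m s \<and> closed_tm m t)"
| "closed_tm m (s \<^bold>* t) = (closed_tm m s \<and> closed_tm m t)"

text \<open>All free number variables are below \<open>m\<close> and all free set variables are below \<open>n\<close>.\<close>

primrec closed :: "nat \<Rightarrow> nat \<Rightarrow> fm \<Rightarrow> bool" where
  "closed m n (s \<^bold>= t) = (closed_tm m s \<and> closed_tm m t)"
| "closed m n (s \<^bold>< t) = (closed_tm m s \<and> closed_tm m t)"
| "closed m n (t \<^bold>\<in> X) = (closed_tm m t \<and> X < n)"
| "closed m n Falsum = True"
| "closed m n (\<phi> \<^bold>\<longrightarrow> \<psi>) = (closed m n \<phi> \<and> closed m n \<psi>)"
| "closed m n (All1 \<phi>) = closed (Suc m) n \<phi>"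
| "closed m n (All2 \<phi>) = closed m (Suc n) \<phi>"

definition closures :: "fm set \<Rightarrow> fm set"
  where "closures \<Phi> = {(All1 ^^ i) ((All2 ^^ j) \<phi>) | i j \<phi>. \<phi> \<in> \<Phi> \<and> closed i j \<phi>}"


section \<open>The base system\<close>

text \<open>
  Bounded-quantifier formulas. The bound \<open>\<up>t\<close> cannot contain the quantified variable; the
  remaining connectives and bounded existential quantifiers are obtained by classical logic.
\<close>

inductive Delta00 :: "fm \<Rightarrow> bool" where
  "Delta00 (s \<^bold>= t)"
| "Delta00 (s \<^bold>< t)"
| "Delta00 (t \<^bold>\<in> X)"
| "Delta00 Falsum"
| "Delta00 \<phi> \<Longrightarrow> Delta00 \<psi> \<Longrightarrow> Delta00 (\<phi> \<^bold>\<longrightarrow> \<psi>)"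
| "Delta00 \<phi> \<Longrightarrow> Delta00 (All1 (Var 0 \<^bold>< \<up>t \<^bold>\<longrightarrow> \<phi>))"

definition Sigma01 :: "fm \<Rightarrow> bool"
  where "Sigma01 \<phi> \<longleftrightarrow> (\<exists>\<theta>. Delta00 \<theta> \<and> \<phi> = Ex1 \<theta>)"

definition Pi01 :: "fm \<Rightarrow> bool"
  where "Pi01 \<phi> \<longleftrightarrow> (\<exists>\<theta>. Delta00 \<theta> \<and> \<phi> = All1 \<theta>)"

definition basic_axioms :: "fm set" where
  "basic_axioms =
    {\<^bold>\<not> (Var 0 \<^bold>+ One \<^bold>= Zero),
     Var 0 \<^bold>+ One \<^bold>= Var 1 \<^bold>+ One \<^bold>\<longrightarrow> Var 0 \<^bold>= Var 1,
     Var 0 \<^bold>+ Zero \<^bold>= Var 0,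
     Var 0 \<^bold>+ (Var 1 \<^bold>+ One) \<^bold>= (Var 0 \<^bold>+ Var 1) \<^bold>+ One,
     Var 0 \<^bold>* Zero \<^bold>= Zero,
     Var 0 \<^bold>* (Var 1 \<^bold>+ One) \<^bold>= Var 0 \<^bold>* Var 1 \<^bold>+ Var 0,
     \<^bold>\<not> (Var 0 \<^bold>< Zero),
     Var 0 \<^bold>< Var 1 \<^bold>+ One \<^bold>\<longleftrightarrow> (Var 0 \<^bold>< Var 1 \<^bold>\<or> Var 0 \<^bold>= Var 1)}"

text \<open>In both schemes the distinguished number variable is variable 0.\<close>

definition induction_axiom :: "fm \<Rightarrow> fm" where
  "induction_axiom \<phi> =
    (inst1 Zero \<phi> \<^bold>\<and>
     All1 (\<phi> \<^bold>\<longrightarrow> subst (case_nat (Var 0 \<^bold>+ One) (\<lambda>i. Var (Suc i))) id \<phi>)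
     \<^bold>\<longrightarrow> All1 \<phi>)"

text \<open>\<open>shift2\<close> expresses that the set being defined does not occur in \<open>\<phi>\<close>.\<close>

definition comprehension_axiom :: "fm \<Rightarrow> fm \<Rightarrow> fm" where
  "comprehension_axiom \<phi> \<psi> =
    (All1 (\<phi> \<^bold>\<longleftrightarrow> \<psi>) \<^bold>\<longrightarrow> Ex2 (All1 (Var 0 \<^bold>\<in> 0 \<^bold>\<longleftrightarrow> shift2 \<phi>)))"

definition RCA0 :: "fm set" where
  "RCA0 = closures
    (basic_axioms
     \<union> {induction_axiom \<phi> | \<phi>. Sigma01 \<phi>}
     \<union> {comprehension_axiom \<phi> \<psi> | \<phi> \<psi>. Sigma01 \<phi> \<and> Pi01 \<psi>})"


section \<open>Functions and infinite sets\<close>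

text \<open>
  The usual pairing \<open>(i, j) = (i + j)\<^sup>2 + i\<close>; a function is the set of the pairs of argument
  and value, a binary function is a function whose arguments are pairs. The term arguments of the
  definitions below are shifted once for every quantifier they are moved under.
\<close>

definition pair :: "tm \<Rightarrow> tm \<Rightarrow> tm"
  where "pair s t = (s \<^bold>+ t) \<^bold>* (s \<^bold>+ t) \<^bold>+ s"

text \<open>\<open>F\<close> is a function from \<open>D\<close> to \<open>C\<close>, where \<open>D\<close> and \<open>C\<close> express membership.\<close>

definition is_fun :: "(tm \<Rightarrow> fm) \<Rightarrow> (tm \<Rightarrow> fm) \<Rightarrow> nat \<Rightarrow> fm" where
  "is_fun D C F =
    (All1 (Var 0 \<^bold>\<in> F \<^bold>\<longrightarrow>
       Ex1 (Ex1 (D (Var 1) \<^bold>\<and> C (Var 0) \<^bold>\<and> Var 2 \<^bold>= pair (Var 1) (Var 0)))) \<^bold>\<and>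
     All1 (D (Var 0) \<^bold>\<longrightarrow> Ex1 (pair (Var 1) (Var 0) \<^bold>\<in> F)) \<^bold>\<and>
     All1 (All1 (All1 (pair (Var 2) (Var 1) \<^bold>\<in> F \<^bold>\<and> pair (Var 2) (Var 0) \<^bold>\<in> F
       \<^bold>\<longrightarrow> Var 1 \<^bold>= Var 0))))"

definition in_N :: "tm \<Rightarrow> fm"
  where "in_N t = (t \<^bold>= t)"

definition in_NxN :: "tm \<Rightarrow> fm"
  where "in_NxN t = Ex1 (Ex1 (\<up>\<up>t \<^bold>= pair (Var 1) (Var 0)))"

text \<open>A two-element set is represented by its increasing enumeration.\<close>

definition in_N_2 :: "tm \<Rightarrow> fm"
  where "in_N_2 t = Ex1 (Ex1 (Var 1 \<^bold>< Var 0 \<^bold>\<and> \<up>\<up>t \<^bold>= pair (Var 1) (Var 0)))"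

definition below :: "nat \<Rightarrow> tm \<Rightarrow> fm"
  where "below k t = (t \<^bold>< numeral_tm k)"

definition infinite_set :: "nat \<Rightarrow> fm"
  where "infinite_set X = All1 (Ex1 (Var 1 \<^bold>\<le> Var 0 \<^bold>\<and> Var 0 \<^bold>\<in> X))"


section \<open>Computably bounded non-decreasing subsequences\<close>

text \<open>\<open>lim\<^sub>s F(x, s) = v\<close>\<close>

definition lim_eq :: "nat \<Rightarrow> tm \<Rightarrow> tm \<Rightarrow> fm" where
  "lim_eq F x v =
    Ex1 (All1 (Var 1 \<^bold>\<le> Var 0 \<^bold>\<longrightarrow> pair (pair (\<up>\<up>x) (Var 0)) (\<up>\<up>v) \<^bold>\<in> F))"

definition limits_exist :: "nat \<Rightarrow> fm"
  where "limits_exist F = All1 (Ex1 (lim_eq F (Var 1) (Var 0)))"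

definition limits_bounded_by :: "nat \<Rightarrow> nat \<Rightarrow> fm" where
  "limits_bounded_by F B =
    All1 (All1 (All1 (lim_eq F (Var 2) (Var 1) \<^bold>\<and> pair (Var 2) (Var 0) \<^bold>\<in> B
      \<^bold>\<longrightarrow> Var 1 \<^bold>\<le> Var 0)))"

definition limits_nondecreasing_on :: "nat \<Rightarrow> nat \<Rightarrow> fm" where
  "limits_nondecreasing_on F X =
    All1 (All1 (Var 1 \<^bold>\<in> X \<^bold>\<and> Var 0 \<^bold>\<in> X \<^bold>\<and> Var 1 \<^bold>< Var 0 \<^bold>\<longrightarrow>
      All1 (All1 (lim_eq F (Var 3) (Var 1) \<^bold>\<and> lim_eq F (Var 2) (Var 0)
        \<^bold>\<longrightarrow> Var 1 \<^bold>\<le> Var 0))))"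

text \<open>Outside \<open>Ex2\<close>, set variable 1 is \<open>f\<close> and 0 is \<open>b\<close>; inside, 2 is \<open>f\<close> and 0 is \<open>X\<close>.\<close>

definition CNS :: fm where
  "CNS = All2 (All2
    (is_fun in_NxN in_N 1 \<^bold>\<and> limits_exist 1 \<^bold>\<and> is_fun in_N in_N 0 \<^bold>\<and> limits_bounded_by 1 0
     \<^bold>\<longrightarrow> Ex2 (infinite_set 0 \<^bold>\<and> limits_nondecreasing_on 2 0)))"


section \<open>Stable Ramsey's theorem for pairs\<close>

text \<open>Since \<open>F\<close> is only defined on increasing pairs, the limit ranges over \<open>s > x\<close>.\<close>

definition stable :: "nat \<Rightarrow> fm" where
  "stable F =
    All1 (Ex1 (Ex1 (All1 (Var 1 \<^bold>\<le> Var 0 \<^bold>\<and> Var 3 \<^bold>< Var 0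
      \<^bold>\<longrightarrow> pair (pair (Var 3) (Var 0)) (Var 2) \<^bold>\<in> F))))"

definition homogeneous :: "nat \<Rightarrow> nat \<Rightarrow> fm" where
  "homogeneous F H =
    Ex1 (All1 (All1 (Var 1 \<^bold>\<in> H \<^bold>\<and> Var 0 \<^bold>\<in> H \<^bold>\<and> Var 1 \<^bold>< Var 0
      \<^bold>\<longrightarrow> pair (pair (Var 1) (Var 0)) (Var 2) \<^bold>\<in> F)))"

definition SRT2 :: "nat \<Rightarrow> fm" where
  "SRT2 k =
    All2 (is_fun in_N_2 (below k) 0 \<^bold>\<and> stable 0
      \<^bold>\<longrightarrow> Ex2 (infinite_set 0 \<^bold>\<and> homogeneous 1 0))"

end

(* By completeness of the natural deduction calculus, it is enough to show that every (possibly
   nonstandard) model of RCA0 + CNS satisfies SRT2 k.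

   In such a model, CNS applied to a stable k-colouring itself yields an infinite set on which the
   limit colours are non-decreasing. As k is standard there is a largest limit colour i on that set,
   so the limit colour is i from some point on: this gives an infinite set Y of limit colour i.
   Thin Y greedily, adding x if it has colour i with every smaller element already added; this is
   recursive in Y and the colouring. That the result is unbounded needs a common bound after which
   all of a bounded set of elements of Y have reached their limit colour, an instance of Sigma^0_2
   collection, which RCA0 does not prove but a second application of CNS does. *)

theory Submission
  imports Defs "HOL-Library.Countable_Set"
begin

section \<open>Completeness of the two-sorted calculus, by Henkin theories\<close>

subsection \<open>Substitution\<close>

text \<open>Working in models replaces long formal derivations by ordinary HOL reasoning; only
  induction and set existence still require explicit formulas. Since the model may be nonstandard,
  neither may be used for a predicate without a formula of the right complexity. The limit colouring
  in particular need not be a set of the model. This is where standardness of k enters: the largest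
  limit colour is found in HOL, as the maximum of a finite set of genuine natural numbers. The
  language has only addition and multiplication, so the course-of-values recursion behind the greedy
  set needs codes of finite sets. A code is a product of pairwise coprime moduli, and membership is
  divisibility. Collection is the obstacle in the last step: each element of Y has its own
  threshold, and without collection the thresholds of the elements below a bound may be unbounded.
  Both applications of CNS concern limits below one fixed element of the model, so a constant
  bounding function suffices.\<close>

lemma subst_tm_Var [simp]: "subst_tm Var t = t"
  by (induction t) auto

lemma subst_tm_comp: "subst_tm \<sigma> (subst_tm \<tau> t) = subst_tm (\<lambda>i. subst_tm \<sigma> (\<tau> i)) t"
  by (induction t) auto

lemma subst_tm_shift: "subst_tm \<sigma> (\<up>t) = subst_tm (\<lambda>i. \<sigma> (Suc i)) t"
  by (simp add: shift_def subst_tm_comp)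

lemma shift_subst_tm: "\<up>(subst_tm \<sigma> t) = subst_tm (\<lambda>i. \<up>(\<sigma> i)) t"
  by (simp add: shift_def subst_tm_comp)

lemma case_nat_Var [simp]: "case_nat (Var 0) (\<lambda>i. Var (Suc i)) = Var"
  by (auto simp: fun_eq_iff split: nat.split)

lemma case_nat_id [simp]: "case_nat 0 Suc = id"
  by (auto simp: fun_eq_iff split: nat.split)

lemma shift_simps [simp]:
  "\<up>(Var i) = Var (Suc i)" "\<up>Zero = Zero" "\<up>One = One"
  "\<up>(s \<^bold>+ t) = \<up>s \<^bold>+ \<up>t" "\<up>(s \<^bold>* t) = \<up>s \<^bold>* \<up>t"
  by (simp_all add: shift_def)

lemma subst_id [simp]: "subst Var id \<phi> = \<phi>"
  by (induction \<phi>) (simp_all add: id_def[symmetric])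

lemma subst_comp:
  "subst \<sigma> \<rho> (subst \<sigma>' \<rho>' \<phi>) = subst (\<lambda>i. subst_tm \<sigma> (\<sigma>' i)) (\<lambda>i. \<rho> (\<rho>' i)) \<phi>"
proof (induction \<phi> arbitrary: \<sigma> \<rho> \<sigma>' \<rho>')
  case (All1 \<phi>)
  have "(\<lambda>i. subst_tm (case_nat (Var 0) (\<lambda>i. \<up>(\<sigma> i))) (case_nat (Var 0) (\<lambda>i. \<up>(\<sigma>' i)) i))
      = case_nat (Var 0) (\<lambda>i. \<up>(subst_tm \<sigma> (\<sigma>' i)))"
    by (auto simp: fun_eq_iff subst_tm_shift shift_subst_tm split: nat.split)
  then show ?case by (simp add: All1)
next
  case (All2 \<phi>)
  have "(\<lambda>i. case_nat 0 (\<lambda>i. Suc (\<rho> i)) (case_nat 0 (\<lambda>i. Suc (\<rho>' i)) i))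
      = case_nat 0 (\<lambda>i. Suc (\<rho> (\<rho>' i)))"
    by (auto simp: fun_eq_iff split: nat.split)
  then show ?case by (simp add: All2)
qed (simp_all add: subst_tm_comp)

lemma subst_tm_cong_closed:
  "closed_tm m t \<Longrightarrow> (\<And>i. i < m \<Longrightarrow> \<sigma> i = \<sigma>' i) \<Longrightarrow> subst_tm \<sigma> t = subst_tm \<sigma>' t"
  by (induction t) auto

lemma subst_cong_closed:
  "closed m n \<phi> \<Longrightarrow> (\<And>i. i < m \<Longrightarrow> \<sigma> i = \<sigma>' i) \<Longrightarrow> (\<And>i. i < n \<Longrightarrow> \<rho> i = \<rho>' i)
    \<Longrightarrow> subst \<sigma> \<rho> \<phi> = subst \<sigma>' \<rho>' \<phi>"
proof (induction \<phi> arbitrary: m n \<sigma> \<rho> \<sigma>' \<rho>')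
  case (All1 \<phi>)
  have "subst (case_nat (Var 0) (\<lambda>i. \<up>(\<sigma> i))) \<rho> \<phi> = subst (case_nat (Var 0) (\<lambda>i. \<up>(\<sigma>' i))) \<rho>' \<phi>"
    by (rule All1.IH[of "Suc m" n]) (use All1.prems in \<open>auto split: nat.split\<close>)
  then show ?case by simp
next
  case (All2 \<phi>)
  have "subst \<sigma> (case_nat 0 (\<lambda>i. Suc (\<rho> i))) \<phi> = subst \<sigma>' (case_nat 0 (\<lambda>i. Suc (\<rho>' i))) \<phi>"
    by (rule All2.IH[of m "Suc n"]) (use All2.prems in \<open>auto split: nat.split\<close>)
  then show ?case by simp
next
  case (Imp \<phi> \<psi>)
  show ?case using Imp.IH[of m n \<sigma> \<sigma>' \<rho> \<rho>'] Imp.prems by simp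
next
  case (Eq s t)
  then show ?case using subst_tm_cong_closed[of m _ \<sigma> \<sigma>'] by simp
next
  case (Less s t)
  then show ?case using subst_tm_cong_closed[of m _ \<sigma> \<sigma>'] by simp
next
  case (Mem t X)
  then show ?case using subst_tm_cong_closed[of m _ \<sigma> \<sigma>'] by simp
qed simp

lemma closed_tm_mono: "closed_tm m t \<Longrightarrow> m \<le> m' \<Longrightarrow> closed_tm m' t"
  by (induction t) auto

lemma closed_mono: "closed m n \<phi> \<Longrightarrow> m \<le> m' \<Longrightarrow> n \<le> n' \<Longrightarrow> closed m' n' \<phi>"
proof (induction \<phi> arbitrary: m n m' n')
  case (All1 \<phi>)
  then show ?case using All1.IH[of "Suc m" n "Suc m'" n'] by simp
next
  case (All2 \<phi>)
  then show ?case using All2.IH[of m "Suc n" m' "Suc n'"] by simp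
qed (auto intro: closed_tm_mono)

lemma closed_tm_exists: "\<exists>m. closed_tm m t"
proof (induction t)
  case (Add s t)
  then show ?case by (auto intro: closed_tm_mono max.cobounded1 max.cobounded2)
next
  case (Mul s t)
  then show ?case by (auto intro: closed_tm_mono max.cobounded1 max.cobounded2)
qed auto

lemma closed_tm_exists2: "\<exists>m. closed_tm m s \<and> closed_tm m t"
  by (meson closed_tm_exists closed_tm_mono max.cobounded1 max.cobounded2)

lemma closed_exists: "\<exists>k. closed k k \<phi>"
proof (induction \<phi>)
  case (Mem t X)
  obtain m where "closed_tm m t" using closed_tm_exists by blast
  then have "closed (max m (Suc X)) (max m (Suc X)) (Mem t X)" by (auto intro: closed_tm_mono)
  then show ?case by blast
next
  case (Imp \<phi> \<psi>)
  then show ?case by (auto intro: closed_mono max.cobounded1 max.cobounded2)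
next
  case (All1 \<phi>)
  then show ?case by (metis closed.simps(6) closed_mono le_SucI order_refl)
next
  case (All2 \<phi>)
  then show ?case by (metis closed.simps(7) closed_mono le_SucI order_refl)
qed (simp_all add: closed_tm_exists2)

lemma closed_exists_finite: "finite \<Delta> \<Longrightarrow> \<exists>k. \<forall>\<phi>\<in>\<Delta>. closed k k \<phi>"
proof (induction rule: finite_induct)
  case (insert \<phi> \<Delta>)
  obtain k where k: "\<forall>\<psi>\<in>\<Delta>. closed k k \<psi>" using insert.IH by blast
  obtain l where l: "closed l l \<phi>" using closed_exists by blast
  have "closed (max k l) (max k l) \<psi>" if "\<psi> \<in> insert \<phi> \<Delta>" for \<psi>
    using that k l by (auto intro: closed_mono)
  then show ?case by blast
qed simp

lemma subst_inst1: "subst \<sigma> \<rho> (inst1 t \<phi>)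
    = inst1 (subst_tm \<sigma> t) (subst (case_nat (Var 0) (\<lambda>i. \<up>(\<sigma> i))) \<rho> \<phi>)"
proof -
  have "(\<lambda>i. subst_tm \<sigma> (case_nat t Var i))
      = (\<lambda>i. subst_tm (case_nat (subst_tm \<sigma> t) Var) (case_nat (Var 0) (\<lambda>i. \<up>(\<sigma> i)) i))"
    by (auto simp: fun_eq_iff subst_tm_shift split: nat.split)
  then show ?thesis by (simp add: inst1_def subst_comp)
qed

lemma subst_inst2: "subst \<sigma> \<rho> (inst2 X \<phi>)
    = inst2 (\<rho> X) (subst \<sigma> (case_nat 0 (\<lambda>i. Suc (\<rho> i))) \<phi>)"
proof -
  have "(\<lambda>i. \<rho> (case_nat X id i)) = (\<lambda>i. case_nat (\<rho> X) id (case_nat 0 (\<lambda>i. Suc (\<rho> i)) i))"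
    by (auto simp: fun_eq_iff split: nat.split)
  then show ?thesis by (simp add: inst2_def subst_comp)
qed

lemma subst_shift1:
  "subst (case_nat (Var 0) (\<lambda>i. \<up>(\<sigma> i))) \<rho> (shift1 \<phi>) = shift1 (subst \<sigma> \<rho> \<phi>)"
  by (simp add: shift1_def subst_comp shift_def)

lemma subst_shift2:
  "subst \<sigma> (case_nat 0 (\<lambda>i. Suc (\<rho> i))) (shift2 \<phi>) = shift2 (subst \<sigma> \<rho> \<phi>)"
  by (simp add: shift2_def subst_comp)

subsection \<open>Derivations\<close>

lemma weaken: "\<Gamma> \<turnstile> \<phi> \<Longrightarrow> \<Gamma> \<subseteq> \<Gamma>' \<Longrightarrow> \<Gamma>' \<turnstile> \<phi>"
proof (induction arbitrary: \<Gamma>' rule: derives.induct)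
  case (Assumption \<phi> \<Gamma>)
  then show ?case by (auto intro: derives.Assumption)
next
  case (Imp_intro \<phi> \<Gamma> \<psi>)
  then show ?case by (meson derives.Imp_intro insert_mono)
next
  case (Imp_elim \<Gamma> \<phi> \<psi>)
  then show ?case by (meson derives.Imp_elim)
next
  case (Classical \<phi> \<Gamma>)
  then show ?case by (meson derives.Classical insert_mono)
next
  case (All1_intro \<Gamma> \<phi>)
  then show ?case by (meson derives.All1_intro image_mono)
next
  case (All2_intro \<Gamma> \<phi>)
  then show ?case by (meson derives.All2_intro image_mono)
next
  case (Eq_subst \<Gamma> s t \<phi>)
  then show ?case by (meson derives.Eq_subst)
qed (auto intro: derives.intros)

lemma derives_subst: "\<Gamma> \<turnstile> \<phi> \<Longrightarrow> subst \<sigma> \<rho> ` \<Gamma> \<turnstile> subst \<sigma> \<rho> \<phi>"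
proof (induction arbitrary: \<sigma> \<rho> rule: derives.induct)
  case (Assumption \<phi> \<Gamma>)
  then show ?case by (auto intro: derives.Assumption)
next
  case (Imp_intro \<phi> \<Gamma> \<psi>)
  then show ?case by (auto intro: derives.Imp_intro)
next
  case (Imp_elim \<Gamma> \<phi> \<psi>)
  then show ?case by (metis derives.Imp_elim subst.simps(5))
next
  case (Classical \<phi> \<Gamma>)
  have "insert (\<^bold>\<not> subst \<sigma> \<rho> \<phi>) (subst \<sigma> \<rho> ` \<Gamma>) \<turnstile> Falsum"
    using Classical.IH[of \<sigma> \<rho>] by (simp add: Neg_def)
  then show ?case by (rule derives.Classical)
next
  case (All1_intro \<Gamma> \<phi>)
  let ?\<sigma> = "case_nat (Var 0) (\<lambda>i. \<up>(\<sigma> i))"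
  have "subst ?\<sigma> \<rho> ` shift1 ` \<Gamma> = shift1 ` subst \<sigma> \<rho> ` \<Gamma>"
    by (simp add: image_image subst_shift1)
  then show ?case using All1_intro.IH[of ?\<sigma> \<rho>] by (simp add: derives.All1_intro)
next
  case (All1_elim \<Gamma> \<phi> t)
  then show ?case by (simp add: subst_inst1 derives.All1_elim)
next
  case (All2_intro \<Gamma> \<phi>)
  let ?\<rho> = "case_nat 0 (\<lambda>i. Suc (\<rho> i))"
  have "subst \<sigma> ?\<rho> ` shift2 ` \<Gamma> = shift2 ` subst \<sigma> \<rho> ` \<Gamma>"
    by (simp add: image_image subst_shift2)
  then show ?case using All2_intro.IH[of \<sigma> ?\<rho>] by (simp add: derives.All2_intro)
next
  case (All2_elim \<Gamma> \<phi> X)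
  then show ?case by (simp add: subst_inst2 derives.All2_elim)
next
  case (Eq_refl \<Gamma> t)
  then show ?case by (simp add: derives.Eq_refl)
next
  case (Eq_subst \<Gamma> s t \<phi>)
  have "subst \<sigma> \<rho> ` \<Gamma> \<turnstile> subst_tm \<sigma> s \<^bold>= subst_tm \<sigma> t" using Eq_subst.IH(1) by simp
  then show ?case using Eq_subst.IH(2)[of \<sigma> \<rho>] unfolding subst_inst1 by (rule derives.Eq_subst)
qed

lemma finite_support: "\<Gamma> \<turnstile> \<phi> \<Longrightarrow> \<exists>\<Gamma>0. finite \<Gamma>0 \<and> \<Gamma>0 \<subseteq> \<Gamma> \<and> (\<Gamma>0 \<turnstile> \<phi>)"
proof (induction rule: derives.induct)
  case (Assumption \<phi> \<Gamma>)
  then have "finite {\<phi>} \<and> {\<phi>} \<subseteq> \<Gamma> \<and> ({\<phi>} \<turnstile> \<phi>)" by (auto intro: derives.Assumption)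
  then show ?case by blast
next
  case (Imp_intro \<phi> \<Gamma> \<psi>)
  then obtain \<Gamma>0 where \<Gamma>0: "finite \<Gamma>0" "\<Gamma>0 \<subseteq> insert \<phi> \<Gamma>" "\<Gamma>0 \<turnstile> \<psi>" by blast
  have "insert \<phi> (\<Gamma>0 - {\<phi>}) \<turnstile> \<psi>" by (rule weaken[OF \<Gamma>0(3)]) auto
  then have "finite (\<Gamma>0 - {\<phi>}) \<and> \<Gamma>0 - {\<phi>} \<subseteq> \<Gamma> \<and> (\<Gamma>0 - {\<phi>} \<turnstile> \<phi> \<^bold>\<longrightarrow> \<psi>)"
    using \<Gamma>0 by (auto intro: derives.Imp_intro)
  then show ?case by blast
next
  case (Imp_elim \<Gamma> \<phi> \<psi>)
  then obtain \<Gamma>0 \<Gamma>1 where \<Gamma>0: "finite \<Gamma>0" "\<Gamma>0 \<subseteq> \<Gamma>" "\<Gamma>0 \<turnstile> \<phi> \<^bold>\<longrightarrow> \<psi>"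
    and \<Gamma>1: "finite \<Gamma>1" "\<Gamma>1 \<subseteq> \<Gamma>" "\<Gamma>1 \<turnstile> \<phi>" by blast
  have "\<Gamma>0 \<union> \<Gamma>1 \<turnstile> \<psi>"
    by (rule derives.Imp_elim[OF weaken[OF \<Gamma>0(3)] weaken[OF \<Gamma>1(3)]]) auto
  then show ?case using \<Gamma>0 \<Gamma>1 by (intro exI[of _ "\<Gamma>0 \<union> \<Gamma>1"]) auto
next
  case (Classical \<phi> \<Gamma>)
  then obtain \<Gamma>0 where \<Gamma>0: "finite \<Gamma>0" "\<Gamma>0 \<subseteq> insert (\<^bold>\<not> \<phi>) \<Gamma>" "\<Gamma>0 \<turnstile> Falsum" by blast
  have "insert (\<^bold>\<not> \<phi>) (\<Gamma>0 - {\<^bold>\<not> \<phi>}) \<turnstile> Falsum" by (rule weaken[OF \<Gamma>0(3)]) auto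
  then have "finite (\<Gamma>0 - {\<^bold>\<not> \<phi>}) \<and> \<Gamma>0 - {\<^bold>\<not> \<phi>} \<subseteq> \<Gamma> \<and> (\<Gamma>0 - {\<^bold>\<not> \<phi>} \<turnstile> \<phi>)"
    using \<Gamma>0 by (auto intro: derives.Classical)
  then show ?case by blast
next
  case (All1_intro \<Gamma> \<phi>)
  then obtain \<Gamma>0 where "finite \<Gamma>0" "\<Gamma>0 \<subseteq> shift1 ` \<Gamma>" "\<Gamma>0 \<turnstile> \<phi>" by blast
  then obtain \<Gamma>1 where "finite \<Gamma>1" "\<Gamma>1 \<subseteq> \<Gamma>" "shift1 ` \<Gamma>1 \<turnstile> \<phi>"
    by (metis finite_subset_image)
  then show ?case by (auto intro: derives.All1_intro)
next
  case (All2_intro \<Gamma> \<phi>)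
  then obtain \<Gamma>0 where "finite \<Gamma>0" "\<Gamma>0 \<subseteq> shift2 ` \<Gamma>" "\<Gamma>0 \<turnstile> \<phi>" by blast
  then obtain \<Gamma>1 where "finite \<Gamma>1" "\<Gamma>1 \<subseteq> \<Gamma>" "shift2 ` \<Gamma>1 \<turnstile> \<phi>"
    by (metis finite_subset_image)
  then show ?case by (auto intro: derives.All2_intro)
next
  case (Eq_refl \<Gamma> t)
  have "{} \<turnstile> t \<^bold>= t" by (rule derives.Eq_refl)
  then show ?case by blast
next
  case (Eq_subst \<Gamma> s t \<phi>)
  then obtain \<Gamma>0 \<Gamma>1 where \<Gamma>0: "finite \<Gamma>0" "\<Gamma>0 \<subseteq> \<Gamma>" "\<Gamma>0 \<turnstile> s \<^bold>= t"
    and \<Gamma>1: "finite \<Gamma>1" "\<Gamma>1 \<subseteq> \<Gamma>" "\<Gamma>1 \<turnstile> inst1 s \<phi>" by blast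
  have "\<Gamma>0 \<union> \<Gamma>1 \<turnstile> inst1 t \<phi>"
    by (rule derives.Eq_subst[OF weaken[OF \<Gamma>0(3)] weaken[OF \<Gamma>1(3)]]) auto
  then show ?case using \<Gamma>0 \<Gamma>1 by (intro exI[of _ "\<Gamma>0 \<union> \<Gamma>1"]) auto
next
  case (All1_elim \<Gamma> \<phi> t)
  then show ?case by (meson derives.All1_elim)
next
  case (All2_elim \<Gamma> \<phi> X)
  then show ?case by (meson derives.All2_elim)
qed

lemma derives_cut: "\<Gamma> \<turnstile> \<phi> \<Longrightarrow> insert \<phi> \<Gamma> \<turnstile> \<psi> \<Longrightarrow> \<Gamma> \<turnstile> \<psi>"
  by (meson Imp_elim Imp_intro)

text \<open>Variable \<open>m\<close> is fresh for the hypotheses. Renaming it to 0 and shifting the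
  variables below it turns the given derivation into one that \<open>All1_intro\<close> accepts,
  which yields the usual eigenvariable rule with a named variable.\<close>

lemma All1_generalize:
  assumes "\<Gamma> \<turnstile> inst1 (Var m) \<phi>" and "\<forall>\<psi>\<in>\<Gamma>. closed m n \<psi>" and "closed (Suc m) n \<phi>"
  shows "\<Gamma> \<turnstile> All1 \<phi>"
proof (rule All1_intro)
  let ?\<sigma> = "\<lambda>i. if i < m then Var (Suc i) else Var 0"
  have "subst ?\<sigma> id \<psi> = shift1 \<psi>" if "\<psi> \<in> \<Gamma>" for \<psi>
    unfolding shift1_def by (rule subst_cong_closed[of m n]) (use that assms in auto)
  then have 1: "subst ?\<sigma> id ` \<Gamma> = shift1 ` \<Gamma>" by auto
  have "subst ?\<sigma> id (inst1 (Var m) \<phi>) = subst Var id \<phi>"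
    unfolding inst1_def subst_comp
    by (rule subst_cong_closed[OF assms(3)]) (auto split: nat.split)
  then show "shift1 ` \<Gamma> \<turnstile> \<phi>" using derives_subst[OF assms(1), of ?\<sigma> id] 1 by simp
qed

lemma All2_generalize:
  assumes "\<Gamma> \<turnstile> inst2 n \<phi>" and "\<forall>\<psi>\<in>\<Gamma>. closed m n \<psi>" and "closed m (Suc n) \<phi>"
  shows "\<Gamma> \<turnstile> All2 \<phi>"
proof (rule All2_intro)
  let ?\<rho> = "\<lambda>i. if i < n then Suc i else 0"
  have "subst Var ?\<rho> \<psi> = shift2 \<psi>" if "\<psi> \<in> \<Gamma>" for \<psi>
    unfolding shift2_def by (rule subst_cong_closed[of m n]) (use that assms in auto)
  then have 1: "subst Var ?\<rho> ` \<Gamma> = shift2 ` \<Gamma>" by auto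
  have "subst Var ?\<rho> (inst2 n \<phi>) = subst Var id \<phi>"
    unfolding inst2_def subst_comp
    by (rule subst_cong_closed[OF assms(3)]) (auto split: nat.split)
  then show "shift2 ` \<Gamma> \<turnstile> \<phi>" using derives_subst[OF assms(1), of Var ?\<rho>] 1 by simp
qed

subsection \<open>Henkin theories\<close>

definition consistent :: "fm set \<Rightarrow> bool"
  where "consistent \<Gamma> \<longleftrightarrow> \<not> (\<Gamma> \<turnstile> Falsum)"

definition henkin :: "fm set \<Rightarrow> bool" where
  "henkin T \<longleftrightarrow> consistent T \<and> (\<forall>\<phi>. \<phi> \<in> T \<or> (\<^bold>\<not> \<phi>) \<in> T)
    \<and> (\<forall>\<phi>. (\<^bold>\<not> All1 \<phi>) \<in> T \<longrightarrow> (\<exists>t. (\<^bold>\<not> inst1 t \<phi>) \<in> T))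
    \<and> (\<forall>\<phi>. (\<^bold>\<not> All2 \<phi>) \<in> T \<longrightarrow> (\<exists>X. (\<^bold>\<not> inst2 X \<phi>) \<in> T))"

text \<open>The negation of a universal formula counts as a decision only together with a
  counterexample, so one pass through all formulas delivers both completeness and Henkin
  witnesses.\<close>

definition decides :: "fm set \<Rightarrow> fm \<Rightarrow> bool" where
  "decides \<Delta>' \<phi> \<longleftrightarrow> (\<phi> \<in> \<Delta>' \<or> (\<^bold>\<not> \<phi>) \<in> \<Delta>' \<and> (\<forall>\<psi>. \<phi> = All1 \<psi> \<longrightarrow> (\<exists>t. (\<^bold>\<not> inst1 t \<psi>) \<in> \<Delta>'))
      \<and> (\<forall>\<psi>. \<phi> = All2 \<psi> \<longrightarrow> (\<exists>X. (\<^bold>\<not> inst2 X \<psi>) \<in> \<Delta>')))"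

text \<open>Free variables serve as Henkin constants: sentences leave all of them unused, and every
  finite set of formulas leaves some unused.\<close>

lemma henkin_step:
  assumes \<Gamma>: "\<forall>\<psi>\<in>\<Gamma>. closed 0 0 \<psi>" and "finite \<Delta>" and con: "consistent (\<Gamma> \<union> \<Delta>)"
  shows "\<exists>\<Delta>'. finite \<Delta>' \<and> consistent (\<Gamma> \<union> \<Delta>') \<and> \<Delta> \<subseteq> \<Delta>' \<and>
    decides \<Delta>' \<phi>"
proof (cases "consistent (insert \<phi> (\<Gamma> \<union> \<Delta>))")
  case True
  then show ?thesis using \<open>finite \<Delta>\<close>
    by (intro exI[of _ "insert \<phi> \<Delta>"]) (auto simp: decides_def)
next
  case False
  then have "\<Gamma> \<union> \<Delta> \<turnstile> \<^bold>\<not> \<phi>" by (simp add: consistent_def Neg_def Imp_intro)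
  then have con': "consistent (insert (\<^bold>\<not> \<phi>) (\<Gamma> \<union> \<Delta>))"
    using con derives_cut unfolding consistent_def by blast
  define \<Theta> where "\<Theta> = insert (\<^bold>\<not> \<phi>) (\<Gamma> \<union> \<Delta>)"
  obtain k where k: "\<forall>\<psi>\<in>insert \<phi> \<Delta>. closed k k \<psi>"
    using closed_exists_finite[of "insert \<phi> \<Delta>"] \<open>finite \<Delta>\<close> by auto
  have k': "\<forall>\<psi>\<in>\<Theta>. closed k k \<psi>"
    using \<Gamma> k closed_mono[of 0 0 _ k k] by (auto simp: \<Theta>_def Neg_def)
  have not: "\<not> (\<Theta> \<turnstile> \<phi>)"
  proof
    assume "\<Theta> \<turnstile> \<phi>"
    moreover have "\<Theta> \<turnstile> \<phi> \<^bold>\<longrightarrow> Falsum" by (rule Assumption) (simp add: \<Theta>_def Neg_def)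
    ultimately have "\<Theta> \<turnstile> Falsum" by (rule Imp_elim[rotated])
    then show False using con' by (simp add: consistent_def \<Theta>_def)
  qed
  \<comment> \<open>For a quantified formula, \<open>\<chi>\<close> will be the instance at the
    fresh variable \<open>k\<close>, which \<open>\<Theta>\<close> cannot prove since generalisation
    would give \<open>\<phi>\<close>; in all other cases it is \<open>\<phi>\<close> itself. By the
    classical rule, adding the negation of an unprovable formula is consistent.\<close>
  have witness: "\<exists>\<Delta>'. finite \<Delta>' \<and> consistent (\<Gamma> \<union> \<Delta>') \<and> \<Delta> \<subseteq> \<Delta>' \<and> decides \<Delta>' \<phi>"
    if "\<not> (\<Theta> \<turnstile> \<chi>)" "decides {\<^bold>\<not> \<chi>, \<^bold>\<not> \<phi>} \<phi>" for \<chi>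
  proof (intro exI[of _ "{\<^bold>\<not> \<chi>, \<^bold>\<not> \<phi>} \<union> \<Delta>"] conjI)
    have "\<Gamma> \<union> ({\<^bold>\<not> \<chi>, \<^bold>\<not> \<phi>} \<union> \<Delta>) = insert (\<^bold>\<not> \<chi>) \<Theta>" by (auto simp: \<Theta>_def)
    then show "consistent (\<Gamma> \<union> ({\<^bold>\<not> \<chi>, \<^bold>\<not> \<phi>} \<union> \<Delta>))"
      using that(1) Classical[of \<chi> \<Theta>] by (auto simp: consistent_def)
    show "decides ({\<^bold>\<not> \<chi>, \<^bold>\<not> \<phi>} \<union> \<Delta>) \<phi>" using that(2) unfolding decides_def by blast
  qed (use \<open>finite \<Delta>\<close> in auto)
  show ?thesis
  proof (cases \<phi>)
    case (All1 \<psi>)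
    then have "\<not> (\<Theta> \<turnstile> inst1 (Var k) \<psi>)" using All1_generalize[of \<Theta> k \<psi> k] k k' not by auto
    then show ?thesis by (rule witness) (auto simp: All1 decides_def)
  next
    case (All2 \<psi>)
    then have "\<not> (\<Theta> \<turnstile> inst2 k \<psi>)" using All2_generalize[of \<Theta> k \<psi> k] k k' not by auto
    then show ?thesis by (rule witness) (auto simp: All2 decides_def)
  qed (rule witness[OF not], simp add: decides_def)+
qed

instance tm :: countable by countable_datatype
instance fm :: countable by countable_datatype

text \<open>Lindenbaum's construction along the numbering of formulas. Every stage has added only
  finitely many formulas to the given sentences, so a fresh variable is always left; finite support
  carries consistency over to the union.\<close>

lemma henkin_extension:
  assumes \<Gamma>: "\<forall>\<psi>\<in>\<Gamma>. closed 0 0 \<psi>" and con: "consistent \<Gamma>"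
  obtains T where "henkin T" "\<Gamma> \<subseteq> T"
proof -
  let ?P = "\<lambda>_ \<Delta>. finite \<Delta> \<and> consistent (\<Gamma> \<union> \<Delta>)"
  let ?Q = "\<lambda>n \<Delta> \<Delta>'. \<Delta> \<subseteq> \<Delta>' \<and> decides \<Delta>' (from_nat n)"
  have "\<exists>\<Delta>. \<forall>n. ?P n (\<Delta> n) \<and> ?Q n (\<Delta> n) (\<Delta> (Suc n))"
  proof (rule dependent_nat_choice)
    show "\<exists>\<Delta>. ?P 0 \<Delta>" using con by (intro exI[of _ "{}"]) simp
  next
    fix \<Delta> n assume "?P n \<Delta>"
    then show "\<exists>\<Delta>'. ?P (Suc n) \<Delta>' \<and> ?Q n \<Delta> \<Delta>'"
      using henkin_step[OF \<Gamma>, of \<Delta> "from_nat n"] by blast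
  qed
  then obtain \<Delta> where PQ: "\<forall>n. ?P n (\<Delta> n) \<and> ?Q n (\<Delta> n) (\<Delta> (Suc n))" ..
  have P: "?P n (\<Delta> n)" and Q: "?Q n (\<Delta> n) (\<Delta> (Suc n))" for n using PQ by auto
  have mono: "\<Delta> m \<subseteq> \<Delta> n" if "m \<le> n" for m n
    using that by (rule lift_Suc_mono_le[rotated]) (use Q in blast)
  define T where "T = \<Gamma> \<union> (\<Union>n. \<Delta> n)"
  have conT: "consistent T"
    unfolding consistent_def
  proof
    assume "T \<turnstile> Falsum"
    then obtain \<Gamma>0 where \<Gamma>0: "finite \<Gamma>0" "\<Gamma>0 \<subseteq> T" "\<Gamma>0 \<turnstile> Falsum" using finite_support by blast
    have "\<exists>n. \<Gamma>0 \<subseteq> \<Gamma> \<union> \<Delta> n"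
      using \<Gamma>0(1,2)
    proof (induction rule: finite_induct)
      case (insert \<phi> F)
      then obtain n m where "F \<subseteq> \<Gamma> \<union> \<Delta> n" "\<phi> \<in> \<Gamma> \<union> \<Delta> m" by (auto simp: T_def)
      then have "insert \<phi> F \<subseteq> \<Gamma> \<union> \<Delta> (max m n)"
        using mono[of m "max m n"] mono[of n "max m n"] by auto
      then show ?case by blast
    qed simp
    then show False using \<Gamma>0(3) P weaken unfolding consistent_def by blast
  qed
  have clash: False if "\<phi> \<in> T" "(\<^bold>\<not> \<phi>) \<in> T" for \<phi>
    using conT that Imp_elim[of T \<phi> Falsum] by (auto simp: consistent_def Neg_def intro: Assumption)
  have sub: "\<Delta> n \<subseteq> T" for n by (auto simp: T_def)
  have dec: "\<phi> \<in> T \<or> (\<^bold>\<not> \<phi>) \<in> T \<and> (\<forall>\<psi>. \<phi> = All1 \<psi> \<longrightarrow> (\<exists>t. (\<^bold>\<not> inst1 t \<psi>) \<in> T))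
      \<and> (\<forall>\<psi>. \<phi> = All2 \<psi> \<longrightarrow> (\<exists>X. (\<^bold>\<not> inst2 X \<psi>) \<in> T))" for \<phi>
    using Q[of "to_nat \<phi>"] sub[of "Suc (to_nat \<phi>)"] unfolding from_nat_to_nat decides_def by blast
  have "henkin T"
    unfolding henkin_def
  proof (intro conjI allI impI)
    show "consistent T" by (rule conT)
    show "\<phi> \<in> T \<or> (\<^bold>\<not> \<phi>) \<in> T" for \<phi> using dec[of \<phi>] by blast
    show "\<exists>t. (\<^bold>\<not> inst1 t \<phi>) \<in> T" if "(\<^bold>\<not> All1 \<phi>) \<in> T" for \<phi>
      using that dec[of "All1 \<phi>"] clash[of "All1 \<phi>"] by blast
    show "\<exists>X. (\<^bold>\<not> inst2 X \<phi>) \<in> T" if "(\<^bold>\<not> All2 \<phi>) \<in> T" for \<phi>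
      using that dec[of "All2 \<phi>"] clash[of "All2 \<phi>"] by blast
  qed
  moreover have "\<Gamma> \<subseteq> T" by (auto simp: T_def)
  ultimately show ?thesis by (rule that)
qed

subsection \<open>Semantics\<close>

text \<open>Henkin semantics: set quantifiers range over \<open>S\<close> only, and its members are
  genuine sets, so extensional comparison is built in.\<close>

locale L2_structure =
  fixes zero one :: 'a and add mul :: "'a \<Rightarrow> 'a \<Rightarrow> 'a" and less :: "'a \<Rightarrow> 'a \<Rightarrow> bool"
    and S :: "'a set set"
begin

notation zero ("\<zero>")
notation one ("\<one>")
notation add (infixl "\<oplus>" 65)
notation mul (infixl "\<otimes>" 70)
notation less (infix "\<prec>" 50)

primrec val :: "(nat \<Rightarrow> 'a) \<Rightarrow> tm \<Rightarrow> 'a" where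
  "val e (Var i) = e i"
| "val e Zero = \<zero>"
| "val e One = \<one>"
| "val e (s \<^bold>+ t) = val e s \<oplus> val e t"
| "val e (s \<^bold>* t) = val e s \<otimes> val e t"

primrec sat :: "(nat \<Rightarrow> 'a) \<Rightarrow> (nat \<Rightarrow> 'a set) \<Rightarrow> fm \<Rightarrow> bool" where
  "sat e E (s \<^bold>= t) \<longleftrightarrow> val e s = val e t"
| "sat e E (s \<^bold>< t) \<longleftrightarrow> val e s \<prec> val e t"
| "sat e E (t \<^bold>\<in> X) \<longleftrightarrow> val e t \<in> E X"
| "sat e E Falsum \<longleftrightarrow> False"
| "sat e E (\<phi> \<^bold>\<longrightarrow> \<psi>) \<longleftrightarrow> (sat e E \<phi> \<longrightarrow> sat e E \<psi>)"
| "sat e E (All1 \<phi>) \<longleftrightarrow> (\<forall>a. sat (case_nat a e) E \<phi>)"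
| "sat e E (All2 \<phi>) \<longleftrightarrow> (\<forall>A\<in>S. sat e (case_nat A E) \<phi>)"

lemma sat_connectives [simp]:
  "sat e E (\<^bold>\<not> \<phi>) \<longleftrightarrow> \<not> sat e E \<phi>"
  "sat e E (\<phi> \<^bold>\<and> \<psi>) \<longleftrightarrow> sat e E \<phi> \<and> sat e E \<psi>"
  "sat e E (\<phi> \<^bold>\<or> \<psi>) \<longleftrightarrow> sat e E \<phi> \<or> sat e E \<psi>"
  "sat e E (\<phi> \<^bold>\<longleftrightarrow> \<psi>) \<longleftrightarrow> (sat e E \<phi> \<longleftrightarrow> sat e E \<psi>)"
  "sat e E (Ex1 \<phi>) \<longleftrightarrow> (\<exists>a. sat (case_nat a e) E \<phi>)"
  "sat e E (Ex2 \<phi>) \<longleftrightarrow> (\<exists>A\<in>S. sat e (case_nat A E) \<phi>)"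
  by (auto simp: Neg_def And_def Or_def Iff_def Ex1_def Ex2_def)

lemma val_subst: "val e (subst_tm \<sigma> t) = val (\<lambda>i. val e (\<sigma> i)) t"
  by (induction t) simp_all

lemma val_shift [simp]: "val (case_nat a e) (\<up>t) = val e t"
  by (simp add: shift_def val_subst)

lemma sat_subst: "sat e E (subst \<sigma> \<rho> \<phi>) = sat (\<lambda>i. val e (\<sigma> i)) (\<lambda>X. E (\<rho> X)) \<phi>"
proof (induction \<phi> arbitrary: e E \<sigma> \<rho>)
  case (All1 \<phi>)
  have "(\<lambda>i. val (case_nat a e) (case_nat (Var 0) (\<lambda>i. \<up>(\<sigma> i)) i))
      = case_nat a (\<lambda>i. val e (\<sigma> i))" for a
    by (auto simp: fun_eq_iff split: nat.split)
  then show ?case by (simp add: All1)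
next
  case (All2 \<phi>)
  have "(\<lambda>X. case_nat A E (case_nat 0 (\<lambda>i. Suc (\<rho> i)) X)) = case_nat A (\<lambda>X. E (\<rho> X))" for A
    by (auto simp: fun_eq_iff split: nat.split)
  then show ?case by (simp add: All2)
qed (simp_all add: val_subst)

lemma val_cong_closed: "closed_tm m t \<Longrightarrow> (\<And>i. i < m \<Longrightarrow> e i = e' i) \<Longrightarrow> val e t = val e' t"
  by (induction t) auto

lemma sat_cong_closed:
  "closed m n \<phi> \<Longrightarrow> (\<And>i. i < m \<Longrightarrow> e i = e' i) \<Longrightarrow> (\<And>i. i < n \<Longrightarrow> E i = E' i)
    \<Longrightarrow> sat e E \<phi> = sat e' E' \<phi>"
proof (induction \<phi> arbitrary: m n e e' E E')
  case (Eq s t)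
  then show ?case using val_cong_closed[of m _ e e'] by simp
next
  case (Less s t)
  then show ?case using val_cong_closed[of m _ e e'] by simp
next
  case (Mem t X)
  then show ?case using val_cong_closed[of m _ e e'] by simp
next
  case (Imp \<phi> \<psi>)
  show ?case using Imp.IH[of m n e e' E E'] Imp.prems by simp
next
  case (All1 \<phi>)
  have "sat (case_nat a e) E \<phi> = sat (case_nat a e') E' \<phi>" for a
    by (rule All1.IH[of "Suc m" n]) (use All1.prems in \<open>auto split: nat.split\<close>)
  then show ?case by simp
next
  case (All2 \<phi>)
  have "sat e (case_nat A E) \<phi> = sat e' (case_nat A E') \<phi>" for A
    by (rule All2.IH[of m "Suc n"]) (use All2.prems in \<open>auto split: nat.split\<close>)
  then show ?case by simp
qed simp

text \<open>The \<open>k\<close> quantifiers leave the first \<open>k\<close> values free. Behind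
  them the original environment follows, displaced by \<open>k\<close>, hence agreement is claimed
  below \<open>k\<close> only; for a formula closed at \<open>k\<close> this is enough.\<close>

lemma sat_All1_funpow:
  "sat e E ((All1 ^^ k) \<phi>) \<Longrightarrow> \<exists>e''. (\<forall>i<k. e'' i = e' i) \<and> sat e'' E \<phi>"
proof (induction k arbitrary: \<phi> e')
  case (Suc k)
  then have "sat e E ((All1 ^^ k) (All1 \<phi>))" by (simp add: funpow_swap1)
  from Suc.IH[OF this, of "\<lambda>i. e' (Suc i)"] obtain e''
    where "\<forall>i<k. e'' i = e' (Suc i)" "sat (case_nat (e' 0) e'') E \<phi>" by auto
  then show ?case by (intro exI[of _ "case_nat (e' 0) e''"]) (auto split: nat.split)
qed auto

lemma sat_All2_funpow:
  "sat e E ((All2 ^^ k) \<phi>) \<Longrightarrow> (\<forall>i. E' i \<in> S) \<Longrightarrow> \<exists>E''. (\<forall>i<k. E'' i = E' i) \<and> sat e E'' \<phi>"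
proof (induction k arbitrary: \<phi> E')
  case (Suc k)
  then have "sat e E ((All2 ^^ k) (All2 \<phi>))" by (simp add: funpow_swap1)
  from Suc.IH[OF this, of "\<lambda>i. E' (Suc i)"] Suc.prems obtain E''
    where "\<forall>i<k. E'' i = E' (Suc i)" "sat e (case_nat (E' 0) E'') \<phi>" by auto
  then show ?case by (intro exI[of _ "case_nat (E' 0) E''"]) (auto split: nat.split)
qed auto

lemma sat_closures:
  assumes "\<forall>\<psi>\<in>closures \<Phi>. sat e E \<psi>" and "\<phi> \<in> \<Phi>" and "\<forall>i. E' i \<in> S"
  shows "sat e' E' \<phi>"
proof -
  obtain k where k: "closed k k \<phi>" using closed_exists by blast
  then have "sat e E ((All1 ^^ k) ((All2 ^^ k) \<phi>))" using assms by (auto simp: closures_def)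
  then obtain e'' where e: "\<forall>i<k. e'' i = e' i" "sat e'' E ((All2 ^^ k) \<phi>)"
    using sat_All1_funpow by blast
  then obtain E'' where "\<forall>i<k. E'' i = E' i" "sat e'' E'' \<phi>"
    using sat_All2_funpow[OF e(2) assms(3)] by blast
  then show ?thesis using sat_cong_closed[OF k, of e'' e' E'' E'] e by simp
qed

end

subsection \<open>Completeness\<close>

text \<open>Syntactic counterpart of extending an environment by one value: it lets the truth lemma
  pass through a number quantifier.\<close>

lemma inst1_subst_lift:
  "inst1 t (subst (case_nat (Var 0) (\<lambda>i. \<up>(\<sigma> i))) \<rho> \<phi>) = subst (case_nat t \<sigma>) \<rho> \<phi>"
proof -
  have "(\<lambda>i. subst_tm (case_nat t Var) (case_nat (Var 0) (\<lambda>i. \<up>(\<sigma> i)) i)) = case_nat t \<sigma>"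
    by (auto simp: fun_eq_iff subst_tm_shift split: nat.split)
  then show ?thesis by (simp add: inst1_def subst_comp)
qed

lemma inst2_subst_lift:
  "inst2 X (subst \<sigma> (case_nat 0 (\<lambda>i. Suc (\<rho> i))) \<phi>) = subst \<sigma> (case_nat X \<rho>) \<phi>"
proof -
  have "(\<lambda>i. case_nat X id (case_nat 0 (\<lambda>i. Suc (\<rho> i)) i)) = case_nat X \<rho>"
    by (auto simp: fun_eq_iff split: nat.split)
  then show ?thesis by (simp add: inst2_def subst_comp)
qed

lemma subst_tm_inst_shift [simp]: "subst_tm (case_nat s Var) (\<up>t) = t"
  by (simp add: subst_tm_shift)

locale henkin_theory =
  fixes T :: "fm set"
  assumes henkin: "henkin T"
begin

lemma derives_iff: "(T \<turnstile> \<phi>) \<longleftrightarrow> \<phi> \<in> T"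
proof
  assume d: "T \<turnstile> \<phi>"
  have "(\<^bold>\<not> \<phi>) \<notin> T"
  proof
    assume "(\<^bold>\<not> \<phi>) \<in> T"
    then have "T \<turnstile> \<phi> \<^bold>\<longrightarrow> Falsum" by (simp add: Neg_def Assumption)
    then have "T \<turnstile> Falsum" using d by (rule Imp_elim)
    then show False using henkin by (simp add: henkin_def consistent_def)
  qed
  then show "\<phi> \<in> T" using henkin by (auto simp: henkin_def)
qed (rule Assumption)

lemma Falsum_notin: "Falsum \<notin> T"
  using henkin Assumption by (auto simp: henkin_def consistent_def)

lemma Imp_iff: "(\<phi> \<^bold>\<longrightarrow> \<psi>) \<in> T \<longleftrightarrow> (\<phi> \<in> T \<longrightarrow> \<psi> \<in> T)"
proof
  show "(\<phi> \<^bold>\<longrightarrow> \<psi>) \<in> T \<Longrightarrow> \<phi> \<in> T \<longrightarrow> \<psi> \<in> T"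
    using Imp_elim[of T \<phi> \<psi>] by (simp add: derives_iff)
  assume imp: "\<phi> \<in> T \<longrightarrow> \<psi> \<in> T"
  show "(\<phi> \<^bold>\<longrightarrow> \<psi>) \<in> T"
  proof (cases "\<psi> \<in> T")
    case True
    then show ?thesis
      using Imp_intro[of \<phi> T \<psi>] Assumption[of \<psi> "insert \<phi> T"] by (simp add: derives_iff)
  next
    case False
    then have "(\<phi> \<^bold>\<longrightarrow> Falsum) \<in> T" using imp henkin by (auto simp: henkin_def Neg_def)
    then have "insert (\<^bold>\<not> \<psi>) (insert \<phi> T) \<turnstile> Falsum"
      using Imp_elim[of "insert (\<^bold>\<not> \<psi>) (insert \<phi> T)" \<phi> Falsum] by (simp add: Assumption)
    then show ?thesis using Imp_intro Classical by (simp flip: derives_iff)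
  qed
qed

lemma Neg_iff: "(\<^bold>\<not> \<phi>) \<in> T \<longleftrightarrow> \<phi> \<notin> T"
  by (simp add: Neg_def Imp_iff Falsum_notin)

lemma All1_iff: "All1 \<phi> \<in> T \<longleftrightarrow> (\<forall>t. inst1 t \<phi> \<in> T)"
  using All1_elim[of T \<phi>] henkin by (auto simp: derives_iff henkin_def Neg_iff)

lemma All2_iff: "All2 \<phi> \<in> T \<longleftrightarrow> (\<forall>X. inst2 X \<phi> \<in> T)"
  using All2_elim[of T \<phi>] henkin by (auto simp: derives_iff henkin_def Neg_iff)

lemma Eq_refl': "(t \<^bold>= t) \<in> T"
  using Eq_refl[of T t] by (simp add: derives_iff)

lemma Eq_subst': "(s \<^bold>= t) \<in> T \<Longrightarrow> inst1 s \<phi> \<in> T \<Longrightarrow> inst1 t \<phi> \<in> T"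
  using Eq_subst[of T s t \<phi>] by (simp add: derives_iff)

lemma Eq_sym: "(s \<^bold>= t) \<in> T \<Longrightarrow> (t \<^bold>= s) \<in> T"
  using Eq_subst'[of s t "Var 0 \<^bold>= \<up>s"] Eq_refl' by (simp add: inst1_def)

lemma Eq_trans: "(s \<^bold>= t) \<in> T \<Longrightarrow> (t \<^bold>= u) \<in> T \<Longrightarrow> (s \<^bold>= u) \<in> T"
  using Eq_subst'[of t u "\<up>s \<^bold>= Var 0"] by (simp add: inst1_def)

lemma Eq_Add: "(s \<^bold>= s') \<in> T \<Longrightarrow> (t \<^bold>= t') \<in> T \<Longrightarrow> (s \<^bold>+ t \<^bold>= s' \<^bold>+ t') \<in> T"
  using Eq_subst'[of s s' "\<up>(s \<^bold>+ t) \<^bold>= Var 0 \<^bold>+ \<up>t"] Eq_subst'[of t t' "\<up>(s \<^bold>+ t) \<^bold>= \<up>s' \<^bold>+ Var 0"]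
    Eq_refl' by (simp add: inst1_def)

lemma Eq_Mul: "(s \<^bold>= s') \<in> T \<Longrightarrow> (t \<^bold>= t') \<in> T \<Longrightarrow> (s \<^bold>* t \<^bold>= s' \<^bold>* t') \<in> T"
  using Eq_subst'[of s s' "\<up>(s \<^bold>* t) \<^bold>= Var 0 \<^bold>* \<up>t"] Eq_subst'[of t t' "\<up>(s \<^bold>* t) \<^bold>= \<up>s' \<^bold>* Var 0"]
    Eq_refl' by (simp add: inst1_def)

lemma Eq_Less: "(s \<^bold>= s') \<in> T \<Longrightarrow> (t \<^bold>= t') \<in> T \<Longrightarrow> (s \<^bold>< t) \<in> T \<Longrightarrow> (s' \<^bold>< t') \<in> T"
  using Eq_subst'[of s s' "Var 0 \<^bold>< \<up>t"] Eq_subst'[of t t' "\<up>s' \<^bold>< Var 0"]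
  by (simp add: inst1_def)

lemma Eq_Mem: "(s \<^bold>= s') \<in> T \<Longrightarrow> (s \<^bold>\<in> X) \<in> T \<Longrightarrow> (s' \<^bold>\<in> X) \<in> T"
  using Eq_subst'[of s s' "Var 0 \<^bold>\<in> X"] by (simp add: inst1_def)

text \<open>Infinitely many classes of terms modulo provable equality can be numbered by \<open>nat\<close>, so
  that equality is interpreted by equality.\<close>

lemma model_exists:
  assumes inj: "\<And>m n. (numeral_tm m \<^bold>= numeral_tm n) \<in> T \<Longrightarrow> m = n"
  obtains zero one :: nat and add mul less S e E
    where "\<forall>i. E i \<in> S" "\<forall>\<phi>\<in>T. L2_structure.sat zero one add mul less S e E \<phi>"
proof -
  define R where "R = {(s, t). (s \<^bold>= t) \<in> T}"
  have R: "equiv UNIV R"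
  proof (rule equivI)
    show "refl R" by (simp add: R_def refl_on_def Eq_refl')
    show "sym R" unfolding R_def sym_def using Eq_sym by blast
    show "trans R" unfolding R_def trans_def using Eq_trans by blast
  qed simp
  have "inj (\<lambda>n. R `` {numeral_tm n})"
  proof (rule injI)
    fix m n assume "R `` {numeral_tm m} = R `` {numeral_tm n}"
    then have "(numeral_tm m, numeral_tm n) \<in> R" using eq_equiv_class_iff[OF R] by simp
    then show "m = n" unfolding R_def using inj by blast
  qed
  then have "infinite (range (\<lambda>n. R `` {numeral_tm n}))" by (simp add: finite_image_iff)
  moreover have "range (\<lambda>n. R `` {numeral_tm n}) \<subseteq> UNIV // R" by (auto simp: quotient_def)
  ultimately have "infinite (UNIV // R)" using finite_subset by blast
  moreover have "countable (UNIV // R)" by (simp add: quotient_def)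
  \<comment> \<open>\<open>sat\<close> quantifies over the whole carrier type, while the classes are
    only some elements of \<open>tm set\<close>. The bijection makes the carrier an entire
    type.\<close>
  ultimately obtain h :: "tm set \<Rightarrow> nat" where h: "bij_betw h (UNIV // R) UNIV"
    by (metis countableE_infinite)
  define c where "c t = h (R `` {t})" for t
  have c_eq: "c s = c t \<longleftrightarrow> (s \<^bold>= t) \<in> T" for s t
  proof -
    have "c s = c t \<longleftrightarrow> R `` {s} = R `` {t}"
      using h unfolding c_def bij_betw_def
      by (intro inj_on_eq_iff[of h "UNIV // R"]) (auto simp: quotientI)
    also have "\<dots> \<longleftrightarrow> (s \<^bold>= t) \<in> T" using eq_equiv_class_iff[OF R] by (simp add: R_def)
    finally show ?thesis .
  qed
  have "\<exists>t. c t = a" for a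
  proof -
    obtain q where "q \<in> UNIV // R" "h q = a" using h unfolding bij_betw_def by (metis UNIV_I imageE)
    then show ?thesis by (auto simp: c_def quotient_def)
  qed
  then obtain r where c_r: "\<And>a. c (r a) = a" by metis
  have rc: "(r (c t) \<^bold>= t) \<in> T" "(t \<^bold>= r (c t)) \<in> T" for t by (simp_all add: c_r flip: c_eq)
  define add where "add a b = c (r a \<^bold>+ r b)" for a b
  define mul where "mul a b = c (r a \<^bold>* r b)" for a b
  define less where "less a b \<longleftrightarrow> (r a \<^bold>< r b) \<in> T" for a b
  define C where "C X = {c t |t. (t \<^bold>\<in> X) \<in> T}" for X
  have add: "add (c s) (c t) = c (s \<^bold>+ t)" for s t by (simp add: add_def c_eq Eq_Add rc)
  have mul: "mul (c s) (c t) = c (s \<^bold>* t)" for s t by (simp add: mul_def c_eq Eq_Mul rc)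
  have less: "less (c s) (c t) \<longleftrightarrow> (s \<^bold>< t) \<in> T" for s t
    unfolding less_def using Eq_Less rc by blast
  have C: "c t \<in> C X \<longleftrightarrow> (t \<^bold>\<in> X) \<in> T" for t X
    unfolding C_def mem_Collect_eq c_eq using Eq_Mem Eq_sym Eq_refl' by blast
  interpret L2_structure "c Zero" "c One" add mul less "range C" .
  have val: "val (\<lambda>i. c (\<sigma> i)) t = c (subst_tm \<sigma> t)" for \<sigma> t
    by (induction t) (simp_all add: add mul)
  \<comment> \<open>An environment of term classes is a substitution read modulo provable equality.
    Generality in \<open>\<sigma>\<close> and \<open>\<rho>\<close> is what the quantifier cases
    need, as they prepend one entry.\<close>
  have truth: "sat (\<lambda>i. c (\<sigma> i)) (\<lambda>X. C (\<rho> X)) \<phi> \<longleftrightarrow> subst \<sigma> \<rho> \<phi> \<in> T" for \<sigma> \<rho> \<phi>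
  proof (induction \<phi> arbitrary: \<sigma> \<rho>)
    case (All1 \<phi>)
    have 1: "case_nat (c t) (\<lambda>i. c (\<sigma> i)) = (\<lambda>i. c (case_nat t \<sigma> i))" for t
      by (auto simp: fun_eq_iff split: nat.split)
    have "(\<forall>a. sat (case_nat a (\<lambda>i. c (\<sigma> i))) (\<lambda>X. C (\<rho> X)) \<phi>)
        \<longleftrightarrow> (\<forall>t. sat (case_nat (c t) (\<lambda>i. c (\<sigma> i))) (\<lambda>X. C (\<rho> X)) \<phi>)"
      by (metis c_r)
    then show ?case by (simp add: 1 All1.IH All1_iff inst1_subst_lift)
  next
    case (All2 \<phi>)
    have 1: "case_nat (C X) (\<lambda>X. C (\<rho> X)) = (\<lambda>Y. C (case_nat X \<rho> Y))" for X
      by (auto simp: fun_eq_iff split: nat.split)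
    show ?case by (simp add: 1 All2.IH All2_iff inst2_subst_lift)
  qed (simp_all add: val c_eq less C Falsum_notin Imp_iff)
  show ?thesis
  proof
    show "\<forall>i. C i \<in> range C" by simp
    show "\<forall>\<phi>\<in>T. sat (\<lambda>i. c (Var i)) C \<phi>" using truth[of Var id] by simp
  qed
qed

end

text \<open>Peeling off successors from an equation between different numerals leaves some t + 1 =
  0. This supplies the infinitely many classes that \<open>model_exists\<close> asks for.\<close>

lemma numeral_tm_inj:
  assumes "henkin T" and "RCA0 \<subseteq> T" and "(numeral_tm m \<^bold>= numeral_tm n) \<in> T"
  shows "m = n"
proof -
  interpret henkin_theory T using assms by unfold_locales
  have cl: "(All1 ^^ 2) \<phi> \<in> T" if "\<phi> \<in> basic_axioms" "closed 2 0 \<phi>" for \<phi>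
  proof -
    have "(All1 ^^ 2) ((All2 ^^ 0) \<phi>) \<in> RCA0"
      unfolding RCA0_def closures_def using that by blast
    then show ?thesis using assms(2) by auto
  qed
  have inst: "subst (case_nat s (case_nat t Var)) id \<phi> \<in> T"
    if "\<phi> \<in> basic_axioms" "closed 2 0 \<phi>" for s t \<phi>
  proof -
    have "inst1 t (All1 \<phi>) \<in> T"
      using cl[OF that] All1_iff[of "All1 \<phi>"] by (simp add: numeral_2_eq_2)
    then have "inst1 s (subst (case_nat (Var 0) (\<lambda>i. \<up>(case_nat t Var i))) id \<phi>) \<in> T"
      using All1_iff by (simp add: inst1_def[of t])
    then show ?thesis by (simp only: inst1_subst_lift)
  qed
  have S0: "(t \<^bold>+ One \<^bold>= Zero) \<notin> T" for t
    using inst[of "\<^bold>\<not> (Var 0 \<^bold>+ One \<^bold>= Zero)" t t]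
    by (simp add: basic_axioms_def Neg_def Imp_iff Falsum_notin)
  have SS: "(s \<^bold>= t) \<in> T" if "(s \<^bold>+ One \<^bold>= t \<^bold>+ One) \<in> T" for s t
    using that inst[of "Var 0 \<^bold>+ One \<^bold>= Var 1 \<^bold>+ One \<^bold>\<longrightarrow> Var 0 \<^bold>= Var 1" s t]
    by (simp add: basic_axioms_def Imp_iff)
  show ?thesis using assms(3)
  proof (induction m arbitrary: n)
    case 0
    then show ?case using S0 Eq_sym by (cases n) auto
  next
    case (Suc m)
    then show ?case using S0 SS by (cases n) auto
  qed
qed

section \<open>Arithmetic, finite sets and recursion inside a model of the base system\<close>

subsection \<open>Bounded formulas\<close>

definition BAll :: "tm \<Rightarrow> fm \<Rightarrow> fm"
  where "BAll t \<phi> = All1 (Var 0 \<^bold>< \<up>t \<^bold>\<longrightarrow> \<phi>)"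

definition BEx :: "tm \<Rightarrow> fm \<Rightarrow> fm"
  where "BEx t \<phi> = (\<^bold>\<not> BAll t (\<^bold>\<not> \<phi>))"

lemma Delta00_connectives:
  "Delta00 \<phi> \<Longrightarrow> Delta00 (\<^bold>\<not> \<phi>)"
  "Delta00 \<phi> \<Longrightarrow> Delta00 \<psi> \<Longrightarrow> Delta00 (\<phi> \<^bold>\<and> \<psi>)"
  "Delta00 \<phi> \<Longrightarrow> Delta00 \<psi> \<Longrightarrow> Delta00 (\<phi> \<^bold>\<or> \<psi>)"
  "Delta00 \<phi> \<Longrightarrow> Delta00 \<psi> \<Longrightarrow> Delta00 (\<phi> \<^bold>\<longleftrightarrow> \<psi>)"
  "Delta00 (s \<^bold>\<le> t)"
  "Delta00 \<phi> \<Longrightarrow> Delta00 (BAll t \<phi>)"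
  "Delta00 \<phi> \<Longrightarrow> Delta00 (BEx t \<phi>)"
  by (simp_all add: Neg_def And_def Or_def Iff_def Le_def BAll_def BEx_def Delta00.intros)

lemmas Delta00_intros = Delta00.intros(1-5) Delta00_connectives

lemma Delta00_subst: "Delta00 \<phi> \<Longrightarrow> Delta00 (subst \<sigma> \<rho> \<phi>)"
proof (induction arbitrary: \<sigma> \<rho> rule: Delta00.induct)
  case (6 \<phi> t)
  have "subst \<sigma> \<rho> (BAll t \<phi>) = BAll (subst_tm \<sigma> t) (subst (case_nat (Var 0) (\<lambda>i. \<up>(\<sigma> i))) \<rho> \<phi>)"
    by (simp add: BAll_def subst_tm_shift shift_subst_tm)
  then show ?case using 6 Delta00_connectives(6) unfolding BAll_def by metis
qed (auto intro: Delta00_intros)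

abbreviation env_cons (infixr "##" 65) where "a ## e \<equiv> case_nat a e"

subsection \<open>Models of the base system\<close>

locale rca0_model = L2_structure +
  assumes S_nonempty: "S \<noteq> {}"
    and axioms: "\<And>\<phi> e E. \<phi> \<in> basic_axioms
     \<union> {induction_axiom \<phi> | \<phi>. Sigma01 \<phi>}
     \<union> {comprehension_axiom \<phi> \<psi> | \<phi> \<psi>. Sigma01 \<phi> \<and> Pi01 \<psi>} \<Longrightarrow> \<forall>i. E i \<in> S \<Longrightarrow> sat e E \<phi>"
begin

text \<open>Padding: each application of a scheme puts its finitely many parameters in front of
  \<open>e0\<close> and \<open>E0\<close>. The entries of \<open>E0\<close> must lie in
  \<open>S\<close>, because the axioms hold only under such assignments.\<close>

definition E0 :: "nat \<Rightarrow> 'a set" where "E0 i = (SOME X. X \<in> S)"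
definition e0 :: "nat \<Rightarrow> 'a" where "e0 i = \<zero>"

lemma E0 [simp]: "E0 i \<in> S"
  using S_nonempty by (simp add: E0_def some_in_eq)

lemma senv_simps [simp]: "(\<forall>i. (X ## E) i \<in> S) \<longleftrightarrow> X \<in> S \<and> (\<forall>i. E i \<in> S)"
  by (auto split: nat.splits)

definition le :: "'a \<Rightarrow> 'a \<Rightarrow> bool" (infix "\<preceq>" 50) where "x \<preceq> y \<longleftrightarrow> x \<prec> y \<or> x = y"

lemma sat_bounded [simp]:
  "sat e E (s \<^bold>\<le> t) \<longleftrightarrow> val e s \<preceq> val e t"
  "sat e E (BAll t \<phi>) \<longleftrightarrow> (\<forall>a. a \<prec> val e t \<longrightarrow> sat (a ## e) E \<phi>)"
  "sat e E (BEx t \<phi>) \<longleftrightarrow> (\<exists>a. a \<prec> val e t \<and> sat (a ## e) E \<phi>)"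
  by (simp_all add: Le_def le_def BAll_def BEx_def)

lemma val_case_nat [simp]: "(\<lambda>i. val e (case_nat t \<sigma> i)) = val e t ## (\<lambda>i. val e (\<sigma> i))"
  by (auto simp: fun_eq_iff split: nat.split)

lemma sat_shift1 [simp]: "sat (a ## e) E (shift1 \<phi>) = sat e E \<phi>"
  by (simp add: shift1_def sat_subst)

text \<open>Interface between HOL predicates and the induction scheme. Every use exhibits a bounded
  matrix for \<open>P\<close>: index 0 is the unbounded witness, index 1 the induction variable, and
  parameters follow.\<close>

lemma sigma_induct:
  assumes "Delta00 \<theta>" and "\<forall>i. E i \<in> S"
    and P: "\<And>x. P x \<longleftrightarrow> (\<exists>y. sat (y ## x ## e) E \<theta>)"
    and "P \<zero>" and "\<And>x. P x \<Longrightarrow> P (x \<oplus> \<one>)"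
  shows "P x"
proof -
  have "Sigma01 (Ex1 \<theta>)" using assms(1) unfolding Sigma01_def by blast
  then have "sat e E (induction_axiom (Ex1 \<theta>))" by (intro axioms assms(2)) blast
  then have "P \<zero> \<and> (\<forall>x. P x \<longrightarrow> P (x \<oplus> \<one>)) \<longrightarrow> (\<forall>x. P x)"
    unfolding induction_axiom_def inst1_def sat_connectives sat.simps sat_subst
      val_case_nat val.simps nat.case id_apply P .
  then show ?thesis using assms(4,5) by blast
qed

lemma delta_induct:
  assumes "Delta00 \<theta>" and "\<forall>i. E i \<in> S" and "\<And>x. P x \<longleftrightarrow> sat (x ## e) E \<theta>"
    and "P \<zero>" and "\<And>x. P x \<Longrightarrow> P (x \<oplus> \<one>)"
  shows "P x"
proof (rule sigma_induct[of "shift1 \<theta>" E P e])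
  show "Delta00 (shift1 \<theta>)" using assms(1) by (simp add: shift1_def Delta00_subst)
  show "P x \<longleftrightarrow> (\<exists>y. sat (y ## x ## e) E (shift1 \<theta>))" for x using assms(3) by simp
qed (use assms in blast)+

text \<open>Here \<open>X\<close> is any HOL set; the two definitions identify it with the set that
  comprehension provides.\<close>

lemma sigma_comprehension:
  assumes "Delta00 \<theta>" and "Delta00 \<eta>" and "\<forall>i. E i \<in> S"
    and \<theta>: "\<And>x. x \<in> X \<longleftrightarrow> (\<exists>y. sat (y ## x ## e) E \<theta>)"
    and \<eta>: "\<And>x. x \<in> X \<longleftrightarrow> (\<forall>y. sat (y ## x ## e) E \<eta>)"
  shows "X \<in> S"
proof -
  have "Sigma01 (Ex1 \<theta>)" "Pi01 (All1 \<eta>)"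
    using assms(1,2) unfolding Sigma01_def Pi01_def by blast+
  then have "sat e E (comprehension_axiom (Ex1 \<theta>) (All1 \<eta>))" by (intro axioms assms(3)) blast
  then have "\<exists>A\<in>S. \<forall>x. x \<in> A \<longleftrightarrow> x \<in> X"
    unfolding comprehension_axiom_def shift2_def sat_connectives sat.simps sat_subst
    by (simp flip: \<theta> \<eta>)
  then show ?thesis by (metis set_eqI)
qed

lemma delta_comprehension:
  assumes "Delta00 \<theta>" and "\<forall>i. E i \<in> S" and "\<And>x. x \<in> X \<longleftrightarrow> sat (x ## e) E \<theta>"
  shows "X \<in> S"
proof (rule sigma_comprehension[of "shift1 \<theta>" "shift1 \<theta>" E X e])
  show "Delta00 (shift1 \<theta>)" "Delta00 (shift1 \<theta>)"
    using assms(1) by (simp_all add: shift1_def Delta00_subst)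
qed (use assms in simp_all)

subsection \<open>Arithmetic\<close>

lemma peano:
  "x \<oplus> \<one> \<noteq> \<zero>" "x \<oplus> \<one> = y \<oplus> \<one> \<Longrightarrow> x = y" "x \<oplus> \<zero> = x" "x \<oplus> (y \<oplus> \<one>) = x \<oplus> y \<oplus> \<one>"
  "x \<otimes> \<zero> = \<zero>" "x \<otimes> (y \<oplus> \<one>) = x \<otimes> y \<oplus> x" "\<not> x \<prec> \<zero>" "x \<prec> y \<oplus> \<one> \<longleftrightarrow> x \<preceq> y"
proof -
  have ax: "\<forall>\<phi>\<in>basic_axioms. sat (x ## y ## e0) E0 \<phi>" using axioms by simp
  show "x \<oplus> \<one> \<noteq> \<zero>" "x \<oplus> \<one> = y \<oplus> \<one> \<Longrightarrow> x = y" "x \<oplus> \<zero> = x" "x \<oplus> (y \<oplus> \<one>) = x \<oplus> y \<oplus> \<one>"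
    "x \<otimes> \<zero> = \<zero>" "x \<otimes> (y \<oplus> \<one>) = x \<otimes> y \<oplus> x" "\<not> x \<prec> \<zero>" "x \<prec> y \<oplus> \<one> \<longleftrightarrow> x \<preceq> y"
    using ax unfolding basic_axioms_def by (simp_all add: le_def)
qed

lemmas [simp] = peano(1,3,5,7) peano(1)[THEN not_sym]

lemma zero_or_succ: "x = \<zero> \<or> (\<exists>y. x = y \<oplus> \<one>)"
proof (rule sigma_induct[where x=x and \<theta>="Var 1 \<^bold>= Zero \<^bold>\<or> Var 1 \<^bold>= Var 0 \<^bold>+ One" and e=e0 and E=E0])
qed (auto intro: Delta00_intros)

lemma add_assoc: "(x \<oplus> y) \<oplus> z = x \<oplus> (y \<oplus> z)"
proof (rule delta_induct[where x=z and \<theta>="(Var 1 \<^bold>+ Var 2) \<^bold>+ Var 0 \<^bold>= Var 1 \<^bold>+ (Var 2 \<^bold>+ Var 0)"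
    and e="x ## y ## e0" and E=E0])
qed (auto intro: Delta00_intros simp: peano(4))

lemma zero_add [simp]: "\<zero> \<oplus> x = x"
proof (rule delta_induct[where x=x and \<theta>="Zero \<^bold>+ Var 0 \<^bold>= Var 0" and e=e0 and E=E0])
qed (auto intro: Delta00_intros simp: peano(4))

lemma one_neq_zero [simp]: "\<one> \<noteq> \<zero>"
  using peano(1)[of \<zero>] by simp

lemma succ_add: "(y \<oplus> \<one>) \<oplus> x = y \<oplus> x \<oplus> \<one>"
proof (rule delta_induct[where x=x and \<theta>="(Var 1 \<^bold>+ One) \<^bold>+ Var 0 \<^bold>= Var 1 \<^bold>+ Var 0 \<^bold>+ One"
    and e="y ## e0" and E=E0])
qed (auto intro: Delta00_intros simp: peano(4))

lemma add_commute: "x \<oplus> y = y \<oplus> x"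
proof (rule delta_induct[where x=y and \<theta>="Var 1 \<^bold>+ Var 0 \<^bold>= Var 0 \<^bold>+ Var 1" and e="x ## e0" and E=E0])
qed (auto intro: Delta00_intros simp: peano(4) succ_add)

lemma add_left_commute: "x \<oplus> (y \<oplus> z) = y \<oplus> (x \<oplus> z)"
  by (metis add_assoc add_commute)

lemmas add_ac = add_assoc add_commute add_left_commute

lemma mul_add: "x \<otimes> (y \<oplus> z) = x \<otimes> y \<oplus> x \<otimes> z"
proof (rule delta_induct[where x=z and \<theta>="Var 1 \<^bold>* (Var 2 \<^bold>+ Var 0) \<^bold>= Var 1 \<^bold>* Var 2 \<^bold>+ Var 1 \<^bold>* Var 0"
    and e="x ## y ## e0" and E=E0])
  fix z assume IH: "x \<otimes> (y \<oplus> z) = x \<otimes> y \<oplus> x \<otimes> z"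
  have "x \<otimes> (y \<oplus> (z \<oplus> \<one>)) = x \<otimes> (y \<oplus> z) \<oplus> x" by (simp add: peano(4,6))
  then show "x \<otimes> (y \<oplus> (z \<oplus> \<one>)) = x \<otimes> y \<oplus> x \<otimes> (z \<oplus> \<one>)"
    by (simp add: IH peano(6) add_assoc)
qed (auto intro: Delta00_intros)

lemma zero_mul [simp]: "\<zero> \<otimes> x = \<zero>"
proof (rule delta_induct[where x=x and \<theta>="Zero \<^bold>* Var 0 \<^bold>= Zero" and e=e0 and E=E0])
qed (auto intro: Delta00_intros simp: peano(6))

lemma succ_mul: "(y \<oplus> \<one>) \<otimes> x = y \<otimes> x \<oplus> x"
proof (rule delta_induct[where x=x and \<theta>="(Var 1 \<^bold>+ One) \<^bold>* Var 0 \<^bold>= Var 1 \<^bold>* Var 0 \<^bold>+ Var 0"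
    and e="y ## e0" and E=E0])
qed (auto intro: Delta00_intros simp: peano(6) add_ac)

lemma mul_commute: "x \<otimes> y = y \<otimes> x"
proof (rule delta_induct[where x=y and \<theta>="Var 1 \<^bold>* Var 0 \<^bold>= Var 0 \<^bold>* Var 1" and e="x ## e0" and E=E0])
qed (auto intro: Delta00_intros simp: peano(6) succ_mul)

lemma add_mul: "(y \<oplus> z) \<otimes> x = y \<otimes> x \<oplus> z \<otimes> x"
  using mul_add mul_commute by simp

lemma mul_one [simp]: "x \<otimes> \<one> = x" "\<one> \<otimes> x = x"
  using peano(6)[of x \<zero>] mul_commute by auto

lemma mul_assoc: "(x \<otimes> y) \<otimes> z = x \<otimes> (y \<otimes> z)"
proof (rule delta_induct[where x=z and \<theta>="(Var 1 \<^bold>* Var 2) \<^bold>* Var 0 \<^bold>= Var 1 \<^bold>* (Var 2 \<^bold>* Var 0)"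
    and e="x ## y ## e0" and E=E0])
qed (auto intro: Delta00_intros simp: mul_add)

lemma mul_left_commute: "x \<otimes> (y \<otimes> z) = y \<otimes> (x \<otimes> z)"
  by (metis mul_assoc mul_commute)

lemmas semiring_simps = add_ac mul_assoc mul_commute mul_left_commute mul_add add_mul

lemma add_right_cancel [simp]: "x \<oplus> z = y \<oplus> z \<longleftrightarrow> x = y"
proof (rule delta_induct[where x=z and \<theta>="Var 1 \<^bold>+ Var 0 \<^bold>= Var 2 \<^bold>+ Var 0 \<^bold>\<longleftrightarrow> Var 1 \<^bold>= Var 2"
    and e="x ## y ## e0" and E=E0])
qed (auto intro: Delta00_intros simp: peano(4) dest: peano(2))

lemma add_left_cancel [simp]: "z \<oplus> x = z \<oplus> y \<longleftrightarrow> x = y"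
  by (simp add: add_commute[of z])

lemma add_eq_self [simp]: "x \<oplus> z = x \<longleftrightarrow> z = \<zero>"
  using add_left_cancel[of x z \<zero>] by simp

lemma add_eq_zero [simp]: "x \<oplus> z = \<zero> \<longleftrightarrow> x = \<zero> \<and> z = \<zero>"
  using zero_or_succ[of z] by (auto simp: peano(4))

lemma less_add_succ: "x \<prec> x \<oplus> z \<oplus> \<one>"
proof (rule delta_induct[where x=z and \<theta>="Var 1 \<^bold>< Var 1 \<^bold>+ Var 0 \<^bold>+ One" and e="x ## e0" and E=E0])
qed (auto intro: Delta00_intros simp: peano(4,8) le_def)

lemma less_imp_add: "x \<prec> y \<longrightarrow> (\<exists>z. y = x \<oplus> z \<oplus> \<one>)"
proof (rule sigma_induct[where x=y and \<theta>="Var 2 \<^bold>< Var 1 \<^bold>\<longrightarrow> Var 1 \<^bold>= Var 2 \<^bold>+ Var 0 \<^bold>+ One"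
    and e="x ## e0" and E=E0])
  fix y assume IH: "x \<prec> y \<longrightarrow> (\<exists>z. y = x \<oplus> z \<oplus> \<one>)"
  show "x \<prec> y \<oplus> \<one> \<longrightarrow> (\<exists>z. y \<oplus> \<one> = x \<oplus> z \<oplus> \<one>)"
  proof
    assume "x \<prec> y \<oplus> \<one>"
    then consider "x = y" | z where "y = x \<oplus> z \<oplus> \<one>" using IH by (auto simp: peano(8) le_def)
    then show "\<exists>z. y \<oplus> \<one> = x \<oplus> z \<oplus> \<one>"
      by cases (metis peano(3), metis peano(4))
  qed
qed (auto intro: Delta00_intros)

text \<open>The axioms describe the order only by recursion on its right-hand side. Expressed
  through addition, transitivity, irreflexivity and monotonicity become algebra.\<close>

lemma less_iff: "x \<prec> y \<longleftrightarrow> (\<exists>z. y = x \<oplus> z \<oplus> \<one>)"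
  using less_add_succ less_imp_add by blast

lemma le_iff: "x \<preceq> y \<longleftrightarrow> (\<exists>z. y = x \<oplus> z)"
proof
  show "x \<preceq> y \<Longrightarrow> \<exists>z. y = x \<oplus> z" unfolding le_def less_iff by (metis add_assoc peano(3))
  assume "\<exists>z. y = x \<oplus> z"
  then obtain z where z: "y = x \<oplus> z" by blast
  show "x \<preceq> y" using zero_or_succ[of z] unfolding z le_def less_iff
    by (auto simp: add_assoc)
qed

lemma zero_le [simp]: "\<zero> \<preceq> x"
  by (auto simp: le_iff)

lemma less_irrefl: "\<not> x \<prec> x"
proof
  assume "x \<prec> x"
  then obtain z where "x \<oplus> (z \<oplus> \<one>) = x" unfolding less_iff by (metis add_assoc)
  then show False by simp
qed

lemma less_trans': "x \<prec> y \<Longrightarrow> y \<prec> z \<Longrightarrow> x \<prec> z"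
  unfolding less_iff by (metis add_assoc)

lemma less_linear': "x \<prec> y \<or> x = y \<or> y \<prec> x"
proof (rule delta_induct[where x=x and \<theta>="Var 0 \<^bold>< Var 1 \<^bold>\<or> Var 0 \<^bold>= Var 1 \<^bold>\<or> Var 1 \<^bold>< Var 0"
    and e="y ## e0" and E=E0])
  show "\<zero> \<prec> y \<or> \<zero> = y \<or> y \<prec> \<zero>" using zero_le[of y] by (auto simp: le_def)
next
  fix x assume "x \<prec> y \<or> x = y \<or> y \<prec> x"
  then consider "y \<preceq> x" | "x \<prec> y" by (auto simp: le_def)
  then show "x \<oplus> \<one> \<prec> y \<or> x \<oplus> \<one> = y \<or> y \<prec> x \<oplus> \<one>"
  proof cases
    case 2
    then obtain z where "y = x \<oplus> \<one> \<oplus> z" unfolding less_iff by (metis add_ac)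
    then have "x \<oplus> \<one> \<preceq> y" by (auto simp: le_iff)
    then show ?thesis by (auto simp: le_def)
  qed (simp add: peano(8))
qed (auto intro: Delta00_intros)

sublocale ord: linorder le less
proof unfold_locales
  fix x y z
  show "x \<prec> y \<longleftrightarrow> x \<preceq> y \<and> \<not> y \<preceq> x"
    unfolding le_def using less_irrefl less_trans' by blast
  show "x \<preceq> y \<Longrightarrow> y \<preceq> z \<Longrightarrow> x \<preceq> z"
    unfolding le_def using less_trans' by blast
  show "x \<preceq> y \<Longrightarrow> y \<preceq> x \<Longrightarrow> x = y"
    unfolding le_def using less_irrefl less_trans' by blast
  show "x \<preceq> y \<or> y \<preceq> x"
    unfolding le_def using less_linear' by blast
qed (simp add: le_def)

lemma less_succ [simp]: "x \<prec> y \<oplus> \<one> \<longleftrightarrow> x \<preceq> y"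
  by (rule peano(8))

lemma succ_le: "x \<oplus> \<one> \<preceq> y \<longleftrightarrow> x \<prec> y"
  using less_succ[of y x] by (meson ord.not_le)

lemma le_add [simp]: "x \<preceq> x \<oplus> y" "x \<preceq> y \<oplus> x"
  using le_iff add_commute by blast+

lemma mul_le_mono: "x \<preceq> x' \<Longrightarrow> y \<preceq> y' \<Longrightarrow> x \<otimes> y \<preceq> x' \<otimes> y'"
proof -
  assume "x \<preceq> x'" "y \<preceq> y'"
  then obtain u v where "x' = x \<oplus> u" "y' = y \<oplus> v" unfolding le_iff by blast
  then have "x' \<otimes> y' = (x \<otimes> y) \<oplus> (x \<otimes> v \<oplus> u \<otimes> y \<oplus> u \<otimes> v)" by (simp add: semiring_simps)
  then show ?thesis unfolding le_iff by blast
qed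

lemma self_le_mul: "y \<noteq> \<zero> \<Longrightarrow> x \<preceq> x \<otimes> y"
  using zero_or_succ[of y] by (auto simp: peano(6))

end

text \<open>Variant of Goedel's beta function: the pair (a, b) codes the set of all s whose modulus
  1 + (s + 1) b divides a. The successor keeps the modulus of 0 from being 1, and bounding the
  quotient keeps the formula bounded.\<close>

definition MEM :: "tm \<Rightarrow> tm \<Rightarrow> tm \<Rightarrow> fm" where
  "MEM s a b = BEx (a \<^bold>+ One) (\<up>a \<^bold>= Var 0 \<^bold>* (One \<^bold>+ (\<up>s \<^bold>+ One) \<^bold>* \<up>b))"

lemma Delta00_MEM: "Delta00 (MEM s a b)"
  unfolding MEM_def by (intro Delta00_intros)

text \<open>Set variable 0 is the ground set and set variable 1 the colouring.\<close>

definition GREEDY :: "tm \<Rightarrow> tm \<Rightarrow> tm \<Rightarrow> tm \<Rightarrow> fm" where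
  "GREEDY n a b i = BAll n (MEM (Var 0) (\<up>a) (\<up>b) \<^bold>\<longleftrightarrow> (Var 0 \<^bold>\<in> 0 \<^bold>\<and>
     BAll (Var 0) (MEM (Var 0) (\<up>\<up>a) (\<up>\<up>b) \<^bold>\<longrightarrow> pair (pair (Var 0) (Var 1)) (\<up>\<up>i) \<^bold>\<in> 1)))"

lemma Delta00_GREEDY: "Delta00 (GREEDY n a b i)"
  unfolding GREEDY_def by (intro Delta00_intros Delta00_MEM)

context rca0_model
begin

subsection \<open>Pairing\<close>

definition pr :: "'a \<Rightarrow> 'a \<Rightarrow> 'a" where "pr x y = (x \<oplus> y) \<otimes> (x \<oplus> y) \<oplus> x"

lemma val_pair [simp]: "val e (pair s t) = pr (val e s) (val e t)"
  by (simp add: pair_def pr_def)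

text \<open>With n = x + y, the code is at most n^2 + n, which is below the next square (n + 1)^2.
  So codes are sorted by the sum of their components, and injectivity follows.\<close>

lemma pr_less: "x \<oplus> y \<prec> x' \<oplus> y' \<Longrightarrow> pr x y \<prec> pr x' y'"
proof -
  assume "x \<oplus> y \<prec> x' \<oplus> y'"
  then have "x \<oplus> y \<oplus> \<one> \<preceq> x' \<oplus> y'" by (simp add: succ_le)
  then have "(x \<oplus> y \<oplus> \<one>) \<otimes> (x \<oplus> y \<oplus> \<one>) \<preceq> (x' \<oplus> y') \<otimes> (x' \<oplus> y')" by (intro mul_le_mono)
  also have "\<dots> \<preceq> pr x' y'" by (simp add: pr_def)
  finally have *: "(x \<oplus> y \<oplus> \<one>) \<otimes> (x \<oplus> y \<oplus> \<one>) \<preceq> pr x' y'" .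
  have "(x \<oplus> y \<oplus> \<one>) \<otimes> (x \<oplus> y \<oplus> \<one>) = (pr x y \<oplus> \<one>) \<oplus> (y \<oplus> (x \<oplus> y))"
    by (simp add: pr_def semiring_simps)
  then have "pr x y \<oplus> \<one> \<preceq> (x \<oplus> y \<oplus> \<one>) \<otimes> (x \<oplus> y \<oplus> \<one>)" by simp
  then have "pr x y \<oplus> \<one> \<preceq> pr x' y'" using * by (rule ord.order_trans)
  then show ?thesis by (simp add: succ_le)
qed

lemma pr_inj [simp]: "pr x y = pr x' y' \<longleftrightarrow> x = x' \<and> y = y'"
proof
  assume eq: "pr x y = pr x' y'"
  then have "x \<oplus> y = x' \<oplus> y'"
    using pr_less[of x y x' y'] pr_less[of x' y' x y] less_linear'[of "x \<oplus> y" "x' \<oplus> y'"]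
    by (auto simp: less_irrefl)
  moreover from this eq have "x = x'" by (simp add: pr_def)
  ultimately show "x = x' \<and> y = y'" by simp
qed simp

text \<open>Searching for the components of a code is thereby a bounded quantifier, so sets of pairs
  are definable by bounded formulas.\<close>

lemma le_pr [simp]: "x \<preceq> pr x y" "y \<preceq> pr x y"
proof -
  show "x \<preceq> pr x y" by (simp add: pr_def)
  show "y \<preceq> pr x y"
  proof (cases "y = \<zero>")
    case False
    have "y \<preceq> x \<oplus> y" by simp
    also have "x \<oplus> y \<preceq> (x \<oplus> y) \<otimes> (x \<oplus> y)" using False by (intro self_le_mul) simp
    also have "\<dots> \<preceq> pr x y" by (simp add: pr_def)
    finally show ?thesis .
  qed simp
qed

subsection \<open>Coding finite sets by divisibility\<close>

definition mem :: "'a \<Rightarrow> 'a \<Rightarrow> 'a \<Rightarrow> bool" where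
  "mem x a b \<longleftrightarrow> (\<exists>q. q \<prec> a \<oplus> \<one> \<and> a = q \<otimes> (\<one> \<oplus> (x \<oplus> \<one>) \<otimes> b))"

lemma sat_MEM [simp]: "sat e E (MEM s a b) \<longleftrightarrow> mem (val e s) (val e a) (val e b)"
  by (simp add: MEM_def mem_def)

lemma bounded_quotient: "p \<noteq> \<zero> \<Longrightarrow> (\<exists>q. q \<prec> a \<oplus> \<one> \<and> a = q \<otimes> p) \<longleftrightarrow> (\<exists>q. a = q \<otimes> p)"
  using self_le_mul less_succ by blast

lemma mem_iff: "mem x a b \<longleftrightarrow> (\<exists>q. a = q \<otimes> (\<one> \<oplus> (x \<oplus> \<one>) \<otimes> b))"
  unfolding mem_def by (rule bounded_quotient) simp

text \<open>The numbers x + 1 with x < n are 1, ..., n, and the induction step multiplies by n + 1.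
  The differences of distinct numbers below n then divide b, which makes the moduli pairwise
  coprime.\<close>

lemma common_multiple: "\<exists>b. b \<noteq> \<zero> \<and> (\<forall>x. x \<prec> n \<longrightarrow> (\<exists>q. q \<prec> b \<oplus> \<one> \<and> b = q \<otimes> (x \<oplus> \<one>)))"
proof (rule sigma_induct[where x=n and e=e0 and E=E0 and
    \<theta>="\<^bold>\<not> (Var 0 \<^bold>= Zero) \<^bold>\<and> BAll (Var 1) (BEx (Var 1 \<^bold>+ One) (Var 2 \<^bold>= Var 0 \<^bold>* (Var 1 \<^bold>+ One)))"])
  fix n assume "\<exists>b. b \<noteq> \<zero> \<and> (\<forall>x. x \<prec> n \<longrightarrow> (\<exists>q. q \<prec> b \<oplus> \<one> \<and> b = q \<otimes> (x \<oplus> \<one>)))"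
  then obtain b where b: "b \<noteq> \<zero>" "\<And>x. x \<prec> n \<Longrightarrow> \<exists>q. b = q \<otimes> (x \<oplus> \<one>)" by blast
  let ?b = "b \<otimes> (n \<oplus> \<one>)"
  have "?b \<noteq> \<zero>" using b(1) by (simp add: mul_add)
  moreover have "\<exists>q. q \<prec> ?b \<oplus> \<one> \<and> ?b = q \<otimes> (x \<oplus> \<one>)" if "x \<prec> n \<oplus> \<one>" for x
  proof -
    have "\<exists>q. ?b = q \<otimes> (x \<oplus> \<one>)"
    proof (cases "x = n")
      case False
      then have "x \<prec> n" using that by (simp add: le_def)
      then obtain q where "b = q \<otimes> (x \<oplus> \<one>)" using b(2) by blast
      then have "?b = (q \<otimes> (n \<oplus> \<one>)) \<otimes> (x \<oplus> \<one>)" by (metis mul_assoc mul_commute)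
      then show ?thesis by blast
    qed blast
    then show ?thesis using bounded_quotient[of "x \<oplus> \<one>" ?b] by simp
  qed
  ultimately show "\<exists>b. b \<noteq> \<zero> \<and> (\<forall>x. x \<prec> n \<oplus> \<one> \<longrightarrow> (\<exists>q. q \<prec> b \<oplus> \<one> \<and> b = q \<otimes> (x \<oplus> \<one>)))"
    by blast
next
  show "\<exists>b. b \<noteq> \<zero> \<and> (\<forall>x. x \<prec> \<zero> \<longrightarrow> (\<exists>q. q \<prec> b \<oplus> \<one> \<and> b = q \<otimes> (x \<oplus> \<one>)))"
    by (rule exI[of _ \<one>]) simp
qed (auto intro!: Delta00_intros)

text \<open>Replaces subtraction of multiples of p. If u exceeds v, cancelling v p leaves a sum
  equal to 0 that contains p.\<close>

lemma divides_cancel: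
  assumes "a \<oplus> u \<otimes> p = v \<otimes> p" and "p \<noteq> \<zero>"
  shows "\<exists>w. a = w \<otimes> p"
proof (cases "u \<preceq> v")
  case True
  then obtain w where "v = u \<oplus> w" by (auto simp: le_iff)
  then have "a \<oplus> u \<otimes> p = w \<otimes> p \<oplus> u \<otimes> p" using assms(1) by (simp add: add_mul add_commute)
  then show ?thesis by auto
next
  case False
  then obtain w where "u = v \<oplus> w \<oplus> \<one>" by (auto simp: ord.not_le less_iff)
  then have "v \<otimes> p \<oplus> (a \<oplus> w \<otimes> p \<oplus> p) = v \<otimes> p" using assms(1) by (simp add: add_mul add_ac)
  then show ?thesis using assms(2) by simp
qed

text \<open>The moduli \<open>1 + (x + 1) b\<close> and \<open>1 + (m + 1) b\<close> are coprime because \<open>x - m\<close> divides \<open>b\<close>;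
  the two identities eliminate the Bezout coefficients.\<close>

lemma mem_mul_cancel:
  assumes b: "\<And>d. d \<prec> n \<Longrightarrow> \<exists>q. b = q \<otimes> (d \<oplus> \<one>)" and "x \<prec> n" "m \<prec> n" "x \<noteq> m"
    and "mem x (a \<otimes> (\<one> \<oplus> (m \<oplus> \<one>) \<otimes> b)) b"
  shows "mem x a b"
proof -
  define X N p where "X = x \<oplus> \<one>" and "N = m \<oplus> \<one>" and "p = \<one> \<oplus> X \<otimes> b"
  have p0: "p \<noteq> \<zero>" by (simp add: p_def)
  obtain t where t: "t \<otimes> p = a \<otimes> (\<one> \<oplus> N \<otimes> b)"
    using assms(5) unfolding mem_iff X_def N_def p_def by metis
  consider "x \<prec> m" | "m \<prec> x" using less_linear' assms(4) by blast
  then have "\<exists>w. a = w \<otimes> p"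
  proof cases
    case 1
    then obtain d where d: "m = x \<oplus> d \<oplus> \<one>" by (auto simp: less_iff)
    then have "d \<prec> m" unfolding less_iff by (metis add_commute)
    then obtain q where q: "b = q \<otimes> (d \<oplus> \<one>)" using b assms(3) less_trans' by blast
    \<comment> \<open>Here N - X = d + 1 and q (d + 1) = b. Writing M for 1 + N b, this gives X^2 q
      M = X N q p - X b, where X b = p - 1. Multiplying by a and moving negative terms across yields
      the equation below.\<close>
    have key: "N \<otimes> q = b \<oplus> X \<otimes> q" unfolding N_def X_def d q by (simp add: semiring_simps)
    have "a \<oplus> (X \<otimes> (a \<otimes> (N \<otimes> q))) \<otimes> p = a \<oplus> a \<otimes> (X \<otimes> b) \<oplus> (X \<otimes> (X \<otimes> q)) \<otimes> (a \<otimes> (\<one> \<oplus> N \<otimes> b))"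
    proof -
      have "(X \<otimes> (X \<otimes> q)) \<otimes> (a \<otimes> (\<one> \<oplus> N \<otimes> b))
          = X \<otimes> (X \<otimes> (q \<otimes> a)) \<oplus> X \<otimes> (X \<otimes> (a \<otimes> (b \<otimes> (N \<otimes> q))))"
        by (simp add: semiring_simps)
      then show ?thesis unfolding key p_def by (simp add: semiring_simps)
    qed
    also have "\<dots> = (a \<oplus> X \<otimes> (X \<otimes> (t \<otimes> q))) \<otimes> p"
    proof -
      have "(a \<oplus> X \<otimes> (X \<otimes> (t \<otimes> q))) \<otimes> p = a \<otimes> p \<oplus> (X \<otimes> (X \<otimes> q)) \<otimes> (t \<otimes> p)"
        by (simp add: semiring_simps)
      then show ?thesis unfolding t by (simp add: p_def semiring_simps)
    qed
    finally show ?thesis using p0 by (rule divides_cancel)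
  next
    case 2
    then obtain d where d: "x = m \<oplus> d \<oplus> \<one>" by (auto simp: less_iff)
    then have "d \<prec> x" unfolding less_iff by (metis add_commute)
    then obtain q where q: "b = q \<otimes> (d \<oplus> \<one>)" using b assms(2) less_trans' by blast
    \<comment> \<open>The difference has changed sign, so the same coefficients now give X^2 q M = X
      N q p + X b, again with X b = p - 1.\<close>
    have key: "X \<otimes> q = b \<oplus> N \<otimes> q" unfolding N_def X_def d q by (simp add: semiring_simps)
    have "a \<oplus> (X \<otimes> (X \<otimes> (t \<otimes> q))) \<otimes> p = a \<oplus> (X \<otimes> (X \<otimes> q)) \<otimes> (t \<otimes> p)"
      by (simp add: semiring_simps)
    also have "\<dots> = a \<oplus> (X \<otimes> (b \<oplus> N \<otimes> q)) \<otimes> (a \<otimes> (\<one> \<oplus> N \<otimes> b))"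
      unfolding t key ..
    also have "\<dots> = (a \<oplus> X \<otimes> (a \<otimes> (N \<otimes> q))) \<otimes> p"
    proof -
      have "(a \<oplus> X \<otimes> (a \<otimes> (N \<otimes> q))) \<otimes> p
          = a \<oplus> a \<otimes> (X \<otimes> b) \<oplus> X \<otimes> (a \<otimes> (N \<otimes> q)) \<oplus> X \<otimes> (a \<otimes> (N \<otimes> (b \<otimes> (X \<otimes> q))))"
        by (simp add: p_def semiring_simps)
      then show ?thesis unfolding key by (simp add: semiring_simps)
    qed
    finally show ?thesis using p0 by (rule divides_cancel)
  qed
  then show ?thesis unfolding mem_iff p_def X_def .
qed

text \<open>Multiply the moduli of the elements of \<open>X\<close>, one at a time; by
  \<open>mem_mul_cancel\<close> no other modulus below \<open>n\<close> starts dividing the product.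
  As \<open>b\<close> is fixed first, only \<open>a\<close> is existentially quantified and the
  induction on \<open>m\<close> is Sigma01.\<close>

lemma finite_code:
  assumes "X \<in> S"
  shows "\<exists>a b. \<forall>x. x \<prec> n \<longrightarrow> (mem x a b \<longleftrightarrow> x \<in> X)"
proof -
  obtain b where b0: "b \<noteq> \<zero>" and b: "\<And>x. x \<prec> n \<Longrightarrow> \<exists>q. b = q \<otimes> (x \<oplus> \<one>)"
    using common_multiple[of n] by blast
  have "\<exists>a. \<forall>x. x \<prec> n \<longrightarrow> (mem x a b \<longleftrightarrow> x \<prec> m \<and> x \<in> X)" for m
  proof (rule sigma_induct[where x=m and e="n ## b ## e0" and E="X ## E0" and
      \<theta>="BAll (Var 2) (MEM (Var 0) (Var 1) (Var 4) \<^bold>\<longleftrightarrow> Var 0 \<^bold>< Var 2 \<^bold>\<and> Var 0 \<^bold>\<in> 0)"])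
    \<comment> \<open>The empty product 1 codes the empty set, since a nonzero \<open>b\<close>
      makes every modulus larger than 1.\<close>
    have "\<not> mem x \<one> b" for x
    proof
      let ?c = "(x \<oplus> \<one>) \<otimes> b"
      assume "mem x \<one> b"
      then obtain q where q: "\<one> = q \<otimes> (\<one> \<oplus> ?c)" unfolding mem_iff by blast
      then have "q \<noteq> \<zero>" by auto
      then have "\<one> \<oplus> ?c \<preceq> \<one>" using self_le_mul[of q "\<one> \<oplus> ?c"] q by (simp add: mul_commute)
      then have "?c = \<zero>" by (auto simp: le_iff add_assoc dest: sym)
      moreover have "b \<preceq> ?c" using self_le_mul[of "x \<oplus> \<one>" b] by (simp add: mul_commute)
      ultimately show False using b0 by (simp add: le_def)
    qed
    then show "\<exists>a. \<forall>x. x \<prec> n \<longrightarrow> (mem x a b \<longleftrightarrow> x \<prec> \<zero> \<and> x \<in> X)" by auto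
  next
    fix m assume "\<exists>a. \<forall>x. x \<prec> n \<longrightarrow> (mem x a b \<longleftrightarrow> x \<prec> m \<and> x \<in> X)"
    then obtain a where a: "\<And>x. x \<prec> n \<Longrightarrow> mem x a b \<longleftrightarrow> x \<prec> m \<and> x \<in> X" by blast
    show "\<exists>a. \<forall>x. x \<prec> n \<longrightarrow> (mem x a b \<longleftrightarrow> x \<prec> m \<oplus> \<one> \<and> x \<in> X)"
    proof (cases "m \<in> X \<and> m \<prec> n")
      case False
      then have "\<forall>x. x \<prec> n \<longrightarrow> (mem x a b \<longleftrightarrow> x \<prec> m \<oplus> \<one> \<and> x \<in> X)"
        using a by (auto simp: le_def)
      then show ?thesis by blast
    next
      case True
      let ?a = "a \<otimes> (\<one> \<oplus> (m \<oplus> \<one>) \<otimes> b)"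
      have "mem m ?a b" unfolding mem_iff by blast
      moreover have "mem x ?a b \<longleftrightarrow> mem x a b" if "x \<prec> n" "x \<noteq> m" for x
      proof
        show "mem x ?a b \<Longrightarrow> mem x a b" using mem_mul_cancel[of n b x m a] b that True by blast
        show "mem x a b \<Longrightarrow> mem x ?a b" unfolding mem_iff by (metis mul_assoc mul_commute)
      qed
      ultimately have "\<forall>x. x \<prec> n \<longrightarrow> (mem x ?a b \<longleftrightarrow> x \<prec> m \<oplus> \<one> \<and> x \<in> X)"
        using a True by (metis le_def less_succ)
      then show ?thesis by blast
    qed
  qed (use assms in \<open>auto intro!: Delta00_intros Delta00_MEM\<close>)
  from this[of n] show ?thesis by blast
qed

subsection \<open>Greedy homogeneous sets\<close>

definition greedy :: "'a set \<Rightarrow> 'a set \<Rightarrow> 'a \<Rightarrow> 'a \<Rightarrow> 'a \<Rightarrow> 'a \<Rightarrow> bool" where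
  "greedy Y F i n a b \<longleftrightarrow> (\<forall>x. x \<prec> n \<longrightarrow>
     (mem x a b \<longleftrightarrow> x \<in> Y \<and> (\<forall>z. z \<prec> x \<longrightarrow> mem z a b \<longrightarrow> pr (pr z x) i \<in> F)))"

lemma sat_GREEDY [simp]:
  "sat e E (GREEDY n a b i) \<longleftrightarrow> greedy (E 0) (E 1) (val e i) (val e n) (val e a) (val e b)"
  by (simp add: GREEDY_def greedy_def)

text \<open>Contracts two unbounded quantifiers into one common bound, as the Sigma01 form allows a
  single one.\<close>

lemma ex2_iff_bounded: "(\<exists>a b. P a b) \<longleftrightarrow> (\<exists>c a. a \<prec> c \<and> (\<exists>b. b \<prec> c \<and> P a b))"
proof
  assume "\<exists>a b. P a b"
  then obtain a b where "P a b" by blast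
  moreover have "a \<prec> a \<oplus> b \<oplus> \<one>" "b \<prec> a \<oplus> b \<oplus> \<one>" by simp_all
  ultimately show "\<exists>c a. a \<prec> c \<and> (\<exists>b. b \<prec> c \<and> P a b)" by blast
qed blast

lemma all2_iff_bounded: "(\<forall>a b. P a b) \<longleftrightarrow> (\<forall>c a. a \<prec> c \<longrightarrow> (\<forall>b. b \<prec> c \<longrightarrow> P a b))"
  using ex2_iff_bounded[of "\<lambda>a b. \<not> P a b"] by blast

lemma greedy_exists:
  assumes "Y \<in> S" and "F \<in> S"
  shows "\<exists>a b. greedy Y F i n a b"
proof (rule sigma_induct[where x=n and e="i ## e0" and E="Y ## F ## E0" and
    \<theta>="BEx (Var 0) (BEx (Var 1) (GREEDY (Var 3) (Var 1) (Var 0) (Var 4)))"])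
  show "\<exists>a b. greedy Y F i \<zero> a b" by (simp add: greedy_def)
next
  fix n assume "\<exists>a b. greedy Y F i n a b"
  then obtain a b where ab: "greedy Y F i n a b" by blast
  define c where "c \<longleftrightarrow> n \<in> Y \<and> (\<forall>z. z \<prec> n \<longrightarrow> mem z a b \<longrightarrow> pr (pr z n) i \<in> F)"
  define X where "X = {x. x \<prec> n \<and> mem x a b \<or> x = n \<and> c}"
  \<comment> \<open>The truth value of \<open>c\<close> is settled outside the formula, which merely
    records the outcome.\<close>
  have "X \<in> S"
    by (rule delta_comprehension[where e="n ## a ## b ## e0" and E=E0 and
      \<theta>="Var 0 \<^bold>< Var 1 \<^bold>\<and> MEM (Var 0) (Var 2) (Var 3) \<^bold>\<or> (if c then Var 0 \<^bold>= Var 1 else Falsum)"])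
      (auto intro!: Delta00_intros Delta00_MEM simp: X_def)
  \<comment> \<open>The number b of a code is chosen for a given range, so the old code is not
    extended; the whole set is coded afresh.\<close>
  then obtain a' b' where code: "\<And>x. x \<prec> n \<oplus> \<one> \<Longrightarrow> mem x a' b' \<longleftrightarrow> x \<in> X"
    using finite_code[of X "n \<oplus> \<one>"] by blast
  have below: "mem x a' b' \<longleftrightarrow> mem x a b" if "x \<prec> n" for x
    using that code[of x] by (auto simp: X_def less_irrefl le_def)
  have top: "mem n a' b' \<longleftrightarrow> c" using code[of n] by (auto simp: X_def less_irrefl)
  have "mem x a' b' \<longleftrightarrow> x \<in> Y \<and> (\<forall>z. z \<prec> x \<longrightarrow> mem z a' b' \<longrightarrow> pr (pr z x) i \<in> F)"
    if "x \<prec> n \<oplus> \<one>" for x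
  proof (cases "x = n")
    case True
    then show ?thesis using top below unfolding c_def by blast
  next
    case False
    then have x: "x \<prec> n" using that by (simp add: le_def)
    then have "mem z a' b' \<longleftrightarrow> mem z a b" if "z \<prec> x" for z using that below less_trans' by blast
    then show ?thesis using below[OF x] ab x unfolding greedy_def by blast
  qed
  then have "greedy Y F i (n \<oplus> \<one>) a' b'" by (simp add: greedy_def)
  then show "\<exists>a b. greedy Y F i (n \<oplus> \<one>) a b" by blast
next
  show "(\<exists>a b. greedy Y F i x a b) \<longleftrightarrow> (\<exists>y. sat (y ## x ## i ## e0) (Y ## F ## E0)
      (BEx (Var 0) (BEx (Var 1) (GREEDY (Var 3) (Var 1) (Var 0) (Var 4)))))" for x
    by (subst ex2_iff_bounded) simp
qed (use assms in \<open>auto intro!: Delta00_intros Delta00_GREEDY\<close>)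

text \<open>The condition at \<open>x\<close> refers only to smaller elements, so agreement
  propagates upwards. The bound \<open>w\<close> turns this course-of-values induction into ordinary
  bounded induction.\<close>

lemma greedy_unique:
  assumes ab: "greedy Y F i n a b" and ab': "greedy Y F i n' a' b'"
  shows "x \<prec> n \<Longrightarrow> x \<prec> n' \<Longrightarrow> mem x a b \<longleftrightarrow> mem x a' b'"
proof -
  have "\<forall>x. x \<prec> w \<longrightarrow> x \<prec> n \<longrightarrow> x \<prec> n' \<longrightarrow> (mem x a b \<longleftrightarrow> mem x a' b')" for w
  proof (rule delta_induct[where x=w and e="n ## n' ## a ## b ## a' ## b' ## e0" and E=E0 and
    \<theta>="BAll (Var 0) (Var 0 \<^bold>< Var 2 \<^bold>\<longrightarrow> Var 0 \<^bold>< Var 3 \<^bold>\<longrightarrow>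
      (MEM (Var 0) (Var 4) (Var 5) \<^bold>\<longleftrightarrow> MEM (Var 0) (Var 6) (Var 7)))"])
    fix w assume IH: "\<forall>x. x \<prec> w \<longrightarrow> x \<prec> n \<longrightarrow> x \<prec> n' \<longrightarrow> (mem x a b \<longleftrightarrow> mem x a' b')"
    have "mem w a b \<longleftrightarrow> mem w a' b'" if "w \<prec> n" "w \<prec> n'"
    proof -
      have "\<And>z. z \<prec> w \<Longrightarrow> mem z a b \<longleftrightarrow> mem z a' b'" using IH that less_trans' by blast
      then show ?thesis using ab ab' that unfolding greedy_def by blast
    qed
    then show "\<forall>x. x \<prec> w \<oplus> \<one> \<longrightarrow> x \<prec> n \<longrightarrow> x \<prec> n' \<longrightarrow> (mem x a b \<longleftrightarrow> mem x a' b')"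
      using IH by (auto simp: le_def)
  qed (auto intro!: Delta00_intros Delta00_MEM)
  from this[of "x \<oplus> \<one>"] show "x \<prec> n \<Longrightarrow> x \<prec> n' \<Longrightarrow> mem x a b \<longleftrightarrow> mem x a' b'" by simp
qed

text \<open>Existence and uniqueness of partial solutions make "some solution contains x" and "every
  solution contains x" equivalent, which is the Delta01 definition that comprehension
  requires.\<close>

lemma greedy_set:
  assumes "Y \<in> S" and "F \<in> S"
  shows "\<exists>H\<in>S. \<forall>x. x \<in> H \<longleftrightarrow> x \<in> Y \<and> (\<forall>z. z \<prec> x \<longrightarrow> z \<in> H \<longrightarrow> pr (pr z x) i \<in> F)"
proof -
  define H where "H = {x. \<exists>a b. greedy Y F i (x \<oplus> \<one>) a b \<and> mem x a b}"
  have H: "x \<in> H \<longleftrightarrow> mem x a b" if "greedy Y F i n a b" "x \<prec> n" for x n a b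
  proof -
    have "mem x a b \<longleftrightarrow> mem x a' b'" if "greedy Y F i (x \<oplus> \<one>) a' b'" for a' b'
      using greedy_unique[OF \<open>greedy Y F i n a b\<close> that] \<open>x \<prec> n\<close> by simp
    then show ?thesis using greedy_exists[OF assms, of i "x \<oplus> \<one>"] unfolding H_def by blast
  qed
  have H': "x \<in> H \<longleftrightarrow> (\<forall>a b. greedy Y F i (x \<oplus> \<one>) a b \<longrightarrow> mem x a b)" for x
  proof -
    have "x \<in> H \<longleftrightarrow> mem x a b" if "greedy Y F i (x \<oplus> \<one>) a b" for a b
      using H[OF that] by simp
    then show ?thesis using greedy_exists[OF assms, of i "x \<oplus> \<one>"] by blast
  qed
  have "H \<in> S"
  proof (rule sigma_comprehension[where e="i ## e0" and E="Y ## F ## E0" and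
      \<theta>="BEx (Var 0) (BEx (Var 1) (GREEDY (Var 3 \<^bold>+ One) (Var 1) (Var 0) (Var 4) \<^bold>\<and> MEM (Var 3) (Var 1) (Var 0)))" and
      \<eta>="BAll (Var 0) (BAll (Var 1) (GREEDY (Var 3 \<^bold>+ One) (Var 1) (Var 0) (Var 4) \<^bold>\<longrightarrow> MEM (Var 3) (Var 1) (Var 0)))"])
    show "x \<in> H \<longleftrightarrow> (\<exists>y. sat (y ## x ## i ## e0) (Y ## F ## E0) (BEx (Var 0) (BEx (Var 1)
      (GREEDY (Var 3 \<^bold>+ One) (Var 1) (Var 0) (Var 4) \<^bold>\<and> MEM (Var 3) (Var 1) (Var 0)))))" for x
      unfolding H_def mem_Collect_eq by (subst ex2_iff_bounded) simp
    show "x \<in> H \<longleftrightarrow> (\<forall>y. sat (y ## x ## i ## e0) (Y ## F ## E0) (BAll (Var 0) (BAll (Var 1)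
      (GREEDY (Var 3 \<^bold>+ One) (Var 1) (Var 0) (Var 4) \<^bold>\<longrightarrow> MEM (Var 3) (Var 1) (Var 0)))))" for x
      unfolding H' by (subst all2_iff_bounded) simp
  qed (use assms in \<open>auto intro!: Delta00_intros Delta00_GREEDY Delta00_MEM\<close>)
  moreover have "x \<in> H \<longleftrightarrow> x \<in> Y \<and> (\<forall>z. z \<prec> x \<longrightarrow> z \<in> H \<longrightarrow> pr (pr z x) i \<in> F)" for x
  proof -
    obtain a b where ab: "greedy Y F i (x \<oplus> \<one>) a b" using greedy_exists[OF assms] by blast
    have z: "z \<in> H \<longleftrightarrow> mem z a b" if "z \<preceq> x" for z using H[OF ab] that by simp
    then have "x \<in> H \<longleftrightarrow> mem x a b" by simp
    also have "\<dots> \<longleftrightarrow> x \<in> Y \<and> (\<forall>z. z \<prec> x \<longrightarrow> mem z a b \<longrightarrow> pr (pr z x) i \<in> F)"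
      using ab by (simp add: greedy_def)
    also have "\<dots> \<longleftrightarrow> x \<in> Y \<and> (\<forall>z. z \<prec> x \<longrightarrow> z \<in> H \<longrightarrow> pr (pr z x) i \<in> F)"
      using z by (auto simp: le_def)
    finally show ?thesis .
  qed
  ultimately show ?thesis by blast
qed

end

section \<open>Limits, collection from CNS, and stable Ramsey's theorem\<close>

text \<open>Formula for the predicate \<open>q\<close> in the proof of \<open>collection\<close>;
  set variable 0 is the set \<open>B\<close> there.\<close>

definition EXCEEDS :: "tm \<Rightarrow> tm \<Rightarrow> tm \<Rightarrow> tm \<Rightarrow> fm" where
  "EXCEEDS a s t z = BEx a (\<up>s \<^bold>\<le> \<up>t \<^bold>\<and> pair (Var 0) (\<up>t) \<^bold>\<in> 0 \<^bold>\<and> \<up>z \<^bold>\<le> Var 0)"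

lemma Delta00_EXCEEDS: "Delta00 (EXCEEDS a s t z)"
  unfolding EXCEEDS_def by (intro Delta00_intros)

context rca0_model
begin

subsection \<open>Functions and limits\<close>

definition graph2 :: "('a \<Rightarrow> 'a \<Rightarrow> 'a) \<Rightarrow> 'a set" where
  "graph2 f = {pr (pr x s) (f x s) | x s. True}"

lemma graph2_iff [simp]: "pr (pr x s) v \<in> graph2 f \<longleftrightarrow> v = f x s"
  by (auto simp: graph2_def)

lemma graph2_in_S:
  assumes "Delta00 \<theta>" and "\<forall>i. E i \<in> S" and \<theta>: "\<And>x s v. v = f x s \<longleftrightarrow> sat (v ## s ## x ## e) E \<theta>"
  shows "graph2 f \<in> S"
proof (rule delta_comprehension[where e=e and E=E])
  \<comment> \<open>The code of the triple now sits at index 3, between v, s, x and the parameters,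
    so the parameters move up by one.\<close>
  define \<theta>' where "\<theta>' = subst (Var 0 ## Var 1 ## Var 2 ## (\<lambda>i. Var (Suc (Suc (Suc (Suc i)))))) id \<theta>"
  let ?\<phi> = "BEx (Var 0 \<^bold>+ One) (BEx (Var 1 \<^bold>+ One) (BEx (Var 2 \<^bold>+ One)
      (Var 3 \<^bold>= pair (pair (Var 2) (Var 1)) (Var 0) \<^bold>\<and> \<theta>')))"
  show "Delta00 ?\<phi>" unfolding \<theta>'_def by (intro Delta00_intros Delta00_subst assms(1))
  have \<theta>': "sat (v ## s ## x ## p ## e) E \<theta>' \<longleftrightarrow> v = f x s" for v s x p
    unfolding \<theta>'_def sat_subst by (simp add: \<theta> id_def)
  show "p \<in> graph2 f \<longleftrightarrow> sat (p ## e) E ?\<phi>" for p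
  proof
    assume "p \<in> graph2 f"
    then obtain x s where p: "p = pr (pr x s) (f x s)" by (auto simp: graph2_def)
    have "x \<preceq> p" "s \<preceq> p" "f x s \<preceq> p"
      unfolding p using le_pr ord.order_trans by blast+
    then show "sat (p ## e) E ?\<phi>" using p by (auto simp: \<theta>')
  qed (auto simp: \<theta>' graph2_def)
qed (rule assms)

lemma const_graph_in_S: "{pr x c | x. True} \<in> S"
proof (rule delta_comprehension[where e="c ## e0" and E=E0])
  show "p \<in> {pr x c | x. True} \<longleftrightarrow> sat (p ## c ## e0) E0 (BEx (Var 0 \<^bold>+ One) (Var 1 \<^bold>= pair (Var 0) (Var 2)))" for p
    by auto
qed (auto intro!: Delta00_intros)

text \<open>The limit \<open>l\<close> is a function of HOL; its graph need not belong to
  \<open>S\<close>.\<close>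

definition converges :: "('a \<Rightarrow> 'a \<Rightarrow> 'a) \<Rightarrow> ('a \<Rightarrow> 'a) \<Rightarrow> bool" where
  "converges f l \<longleftrightarrow> (\<forall>x. \<exists>s0. \<forall>s. s0 \<preceq> s \<longrightarrow> f x s = l x)"

lemma sat_lim_eq:
  assumes "E F = graph2 f" and "converges f l"
  shows "sat e E (lim_eq F x v) \<longleftrightarrow> val e v = l (val e x)"
proof -
  obtain s0 where s0: "\<And>s. s0 \<preceq> s \<Longrightarrow> f (val e x) s = l (val e x)"
    using assms(2) unfolding converges_def by blast
  have "(\<exists>s1. \<forall>s. s1 \<preceq> s \<longrightarrow> val e v = f (val e x) s) \<longleftrightarrow> val e v = l (val e x)"
  proof
    assume "\<exists>s1. \<forall>s. s1 \<preceq> s \<longrightarrow> val e v = f (val e x) s"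
    then obtain s1 where "\<And>s. s1 \<preceq> s \<Longrightarrow> val e v = f (val e x) s" by blast
    then show "val e v = l (val e x)" using s0 ord.linear by metis
  qed (metis s0)
  then show ?thesis using assms(1) by (simp add: lim_eq_def)
qed

lemma CNS_sem:
  assumes cns: "\<And>e E. sat e E CNS" and f: "graph2 f \<in> S" and l: "converges f l"
    and c: "\<And>x. l x \<preceq> c"
  obtains X where "X \<in> S" "\<And>w. \<exists>x\<in>X. w \<preceq> x" "\<And>x y. x \<in> X \<Longrightarrow> y \<in> X \<Longrightarrow> x \<prec> y \<Longrightarrow> l x \<preceq> l y"
proof -
  let ?B = "{pr x c | x. True}"
  let ?E = "?B ## graph2 f ## E0"
  have "sat e0 ?E (is_fun in_NxN in_N 1)"
    by (auto simp: is_fun_def in_NxN_def in_N_def graph2_def)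
  moreover have "sat e0 ?E (limits_exist 1)"
    by (simp add: limits_exist_def sat_lim_eq[OF _ l])
  moreover have "sat e0 ?E (is_fun in_N in_N 0)"
    by (auto simp: is_fun_def in_N_def)
  moreover have "sat e0 ?E (limits_bounded_by 1 0)"
    using c by (auto simp: limits_bounded_by_def sat_lim_eq[OF _ l])
  ultimately have "sat e0 ?E (Ex2 (infinite_set 0 \<^bold>\<and> limits_nondecreasing_on 2 0))"
    using cns[of e0 E0] f const_graph_in_S[of c] unfolding CNS_def
    by (simp del: sat_connectives(6))
  then obtain X where X: "X \<in> S" "sat e0 (X ## ?E) (infinite_set 0)"
    "sat e0 (X ## ?E) (limits_nondecreasing_on 2 0)" by auto
  show ?thesis
  proof
    show "\<exists>x\<in>X. w \<preceq> x" for w using X(2) by (auto simp: infinite_set_def)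
    show "l x \<preceq> l y" if "x \<in> X" "y \<in> X" "x \<prec> y" for x y
      using X(3) that by (simp add: limits_nondecreasing_on_def sat_lim_eq[OF _ l])
  qed (rule X(1))
qed

subsection \<open>Collection\<close>

text \<open>Without a last element, \<open>Q\<close> would be closed under successor, and Sigma01
  induction would carry it up to \<open>a\<close>.\<close>

lemma least_of_downward_closed:
  assumes "Delta00 \<theta>" and "\<forall>i. E i \<in> S" and Q: "\<And>z. Q z \<longleftrightarrow> (\<exists>y. sat (y ## z ## e) E \<theta>)"
    and down: "\<And>w z. w \<preceq> z \<Longrightarrow> Q z \<Longrightarrow> Q w" and a: "\<not> Q a"
  shows "\<exists>z. \<forall>w. w \<prec> z \<longleftrightarrow> Q w"
proof (cases "Q \<zero>")
  case False
  then have "\<forall>w. w \<prec> \<zero> \<longleftrightarrow> Q w" using down zero_le by auto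
  then show ?thesis by blast
next
  case True
  have "\<exists>z. Q z \<and> \<not> Q (z \<oplus> \<one>)"
  proof (rule ccontr)
    assume "\<nexists>z. Q z \<and> \<not> Q (z \<oplus> \<one>)"
    then have "Q z" for z using sigma_induct[of \<theta> E Q e z] assms(1,2) Q True by blast
    then show False using a by blast
  qed
  then obtain z where z: "Q z" "\<not> Q (z \<oplus> \<one>)" by blast
  have "w \<prec> z \<oplus> \<one> \<longleftrightarrow> Q w" for w
    using down[of w z] down[of "z \<oplus> \<one>" w] z by (metis less_succ ord.not_le)
  then show ?thesis by blast
qed

text \<open>Let \<open>l s\<close> be the least strict upper bound of the \<open>x < a\<close> with \<open>(x, t) \<in> B\<close> for some
  \<open>t \<ge> s\<close>. It is the limit of its approximations by the \<open>t < u\<close>, and it is non-increasing in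
  \<open>s\<close>; on a set where it is also non-decreasing it is constant, so a single \<open>x\<close> has arbitrarily
  large \<open>t\<close>.\<close>

lemma collection:
  assumes cns: "\<And>e E. sat e E CNS" and B: "B \<in> S"
    and lim: "\<And>x. x \<prec> a \<Longrightarrow> \<exists>s. \<forall>t. s \<preceq> t \<longrightarrow> pr x t \<notin> B"
  shows "\<exists>s. \<forall>x t. x \<prec> a \<longrightarrow> s \<preceq> t \<longrightarrow> pr x t \<notin> B"
proof (rule ccontr)
  assume contra: "\<not> ?thesis"
  define q where "q s t z \<longleftrightarrow> (\<exists>x. x \<prec> a \<and> s \<preceq> t \<and> pr x t \<in> B \<and> z \<preceq> x)" for s t z
  let ?E = "B ## E0"
  have sat_q: "sat e ?E (EXCEEDS k s t z) \<longleftrightarrow> q (val e s) (val e t) (val e z)" if "val e k = a" for e k s t z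
    using that by (simp add: EXCEEDS_def q_def)
  have down: "q s t w" if "w \<preceq> z" "q s t z" for s t w z
    using that unfolding q_def using ord.order_trans by blast
  have qa: "\<not> q s t a" for s t unfolding q_def by (auto simp: ord.not_le)
  have f_ex: "\<exists>z. \<forall>w. w \<prec> z \<longleftrightarrow> (\<exists>t. t \<prec> u \<and> q s t w)" for s u
  proof (rule least_of_downward_closed[where a=a and e="u ## s ## a ## e0" and E="?E" and
      \<theta>="Var 0 \<^bold>< Var 2 \<^bold>\<and> EXCEEDS (Var 4) (Var 3) (Var 0) (Var 1)"])
    show "\<exists>t. t \<prec> u \<and> q s t w" if "w \<preceq> z" "\<exists>t. t \<prec> u \<and> q s t z" for w z
      using that down by blast
    show "\<nexists>t. t \<prec> u \<and> q s t a" using qa by blast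
  qed (use B in \<open>auto intro!: Delta00_intros Delta00_EXCEEDS simp: sat_q\<close>)
  \<comment> \<open>As an instance of CNS, the threshold \<open>s\<close> is the argument and
    \<open>u\<close> the stage of the approximation.\<close>
  define f where "f s u = (SOME z. \<forall>w. w \<prec> z \<longleftrightarrow> (\<exists>t. t \<prec> u \<and> q s t w))" for s u
  have f: "w \<prec> f s u \<longleftrightarrow> (\<exists>t. t \<prec> u \<and> q s t w)" for s u w
    using someI_ex[OF f_ex[of u s]] unfolding f_def by blast
  have l_ex: "\<exists>z. \<forall>w. w \<prec> z \<longleftrightarrow> (\<exists>t. q s t w)" for s
  proof (rule least_of_downward_closed[where a=a and e="s ## a ## e0" and E="?E" and
      \<theta>="EXCEEDS (Var 3) (Var 2) (Var 0) (Var 1)"])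
    show "\<exists>t. q s t w" if "w \<preceq> z" "\<exists>t. q s t z" for w z
      using that down by blast
    show "\<nexists>t. q s t a" using qa by blast
  qed (use B in \<open>auto intro!: Delta00_intros Delta00_EXCEEDS simp: sat_q\<close>)
  define l where "l s = (SOME z. \<forall>w. w \<prec> z \<longleftrightarrow> (\<exists>t. q s t w))" for s
  have l: "w \<prec> l s \<longleftrightarrow> (\<exists>t. q s t w)" for s w
    using someI_ex[OF l_ex[of s]] unfolding l_def by blast
  have eqI: "y = z" if "\<And>w. w \<prec> y \<longleftrightarrow> w \<prec> z" for y z
    using that less_linear' less_irrefl by blast
  \<comment> \<open>A bounded description of the value chosen by \<open>SOME\<close>; it puts the
    graph of \<open>f\<close> into \<open>S\<close>.\<close>
  have f_eq: "v = f s u \<longleftrightarrow> (\<forall>t. t \<prec> u \<longrightarrow> \<not> q s t v) \<and> (\<forall>w. w \<prec> v \<longrightarrow> (\<exists>t. t \<prec> u \<and> q s t w))" for v s u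
  proof
    assume "v = f s u"
    then show "(\<forall>t. t \<prec> u \<longrightarrow> \<not> q s t v) \<and> (\<forall>w. w \<prec> v \<longrightarrow> (\<exists>t. t \<prec> u \<and> q s t w))"
      using f less_irrefl by blast
  next
    assume v: "(\<forall>t. t \<prec> u \<longrightarrow> \<not> q s t v) \<and> (\<forall>w. w \<prec> v \<longrightarrow> (\<exists>t. t \<prec> u \<and> q s t w))"
    show "v = f s u"
    proof (rule eqI)
      show "w \<prec> v \<longleftrightarrow> w \<prec> f s u" for w
        unfolding f using v down ord.not_le by blast
    qed
  qed
  have "graph2 f \<in> S"
    by (rule graph2_in_S[where e="a ## e0" and E="?E" and
        \<theta>="BAll (Var 1) (\<^bold>\<not> EXCEEDS (Var 4) (Var 3) (Var 0) (Var 1)) \<^bold>\<and>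
          BAll (Var 0) (BEx (Var 2) (EXCEEDS (Var 5) (Var 4) (Var 0) (Var 1)))"])
      (use B in \<open>auto intro!: Delta00_intros Delta00_EXCEEDS simp: sat_q f_eq\<close>)
  moreover have "converges f l"
    unfolding converges_def
  proof
    fix s
    show "\<exists>u0. \<forall>u. u0 \<preceq> u \<longrightarrow> f s u = l s"
    proof (cases "l s = \<zero>")
      case True
      then have "f s u = \<zero>" for u using l f zero_or_succ[of "f s u"]
        by (metis less_succ ord.order_refl peano(7))
      then show ?thesis using True by simp
    next
      case False
      then obtain z where z: "l s = z \<oplus> \<one>" using zero_or_succ by blast
      then obtain t where t: "q s t z" using l[of z s] by auto
      \<comment> \<open>A \<open>t\<close> witnessing the largest value \<open>z\<close> witnesses
        all smaller ones by \<open>down\<close>, so every stage beyond this \<open>t\<close> has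
        reached the limit.\<close>
      have "f s u = l s" if "t \<oplus> \<one> \<preceq> u" for u
      proof (rule eqI)
        have "t \<prec> u" using that by (simp add: succ_le)
        then show "w \<prec> f s u \<longleftrightarrow> w \<prec> l s" for w
          using t down l[of w s] unfolding f z by (metis less_succ)
      qed
      then show ?thesis by blast
    qed
  qed
  moreover have "l s \<preceq> a" for s
    using l[of a s] qa by (meson ord.not_le)
  ultimately obtain X where X: "X \<in> S" "\<And>w. \<exists>x\<in>X. w \<preceq> x"
    and mono: "\<And>x y. x \<in> X \<Longrightarrow> y \<in> X \<Longrightarrow> x \<prec> y \<Longrightarrow> l x \<preceq> l y"
    by (rule CNS_sem[OF cns]) blast
  have anti: "l s' \<preceq> l s" if "s \<preceq> s'" for s s'
  proof -
    have "q s' t z \<Longrightarrow> q s t z" for t z using that unfolding q_def by (blast intro: ord.order_trans)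
    then have "w \<prec> l s' \<Longrightarrow> w \<prec> l s" for w using l by blast
    then show ?thesis using less_irrefl by (meson ord.not_le)
  qed
  obtain x0 where x0: "x0 \<in> X" using X(2) by blast
  have const: "l x = l x0" if "x \<in> X" "x0 \<preceq> x" for x
    using that anti[of x0 x] mono[of x0 x] x0 by (auto simp: le_def[of x0 x] intro: ord.order.antisym)
  \<comment> \<open>Failure of collection at the threshold \<open>x0\<close> makes the constant
    value positive, so it has a predecessor \<open>z\<close>.\<close>
  obtain x t where "x \<prec> a" "x0 \<preceq> t" "pr x t \<in> B" using contra by blast
  then have "\<zero> \<prec> l x0" using l unfolding q_def by auto
  then obtain z where z: "l x0 = z \<oplus> \<one>" using zero_or_succ[of "l x0"] by auto
  \<comment> \<open>Beyond every threshold some x >= z occurs, while z + 1 is out of reach; so it is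
    \<open>z\<close> itself, the same one every time, against \<open>lim\<close>.\<close>
  have hit: "\<exists>t. s \<preceq> t \<and> pr z t \<in> B \<and> z \<prec> a" for s
  proof -
    obtain y where y: "y \<in> X" "s \<preceq> y" "x0 \<preceq> y"
      using X(2)[of "s \<oplus> x0"] ord.order_trans le_add by blast
    have ly: "l y = z \<oplus> \<one>" using const y z by simp
    then obtain t where "q y t z" using l[of z y] by auto
    then obtain x where x: "x \<prec> a" "y \<preceq> t" "pr x t \<in> B" "z \<preceq> x" unfolding q_def by blast
    have "\<not> q y t (z \<oplus> \<one>)" using l[of "z \<oplus> \<one>" y] ly less_irrefl by auto
    then have "\<not> z \<oplus> \<one> \<preceq> x" using x unfolding q_def by blast
    then have "x = z" using x(4) by (auto simp: succ_le le_def[of z x])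
    then show ?thesis using x y ord.order_trans by blast
  qed
  then show False using lim[of z] by blast
qed

subsection \<open>Stable Ramsey's theorem\<close>

definition num :: "nat \<Rightarrow> 'a" where "num k = val e0 (numeral_tm k)"

lemma val_numeral [simp]: "val e (numeral_tm k) = num k"
proof -
  have "val e (numeral_tm k) = val e' (numeral_tm k)" for e e' by (induction k) simp_all
  then show ?thesis unfolding num_def by blast
qed

lemma num_simps [simp]: "num 0 = \<zero>" "num (Suc k) = num k \<oplus> \<one>"
  by (simp_all add: num_def del: val_numeral)

text \<open>This uses that k is standard: even a nonstandard model has only numerals below a
  numeral.\<close>

lemma less_num: "x \<prec> num k \<Longrightarrow> \<exists>j<k. x = num j"
  by (induction k) (auto simp: le_def less_Suc_eq)

lemma num_mono: "j \<le> k \<Longrightarrow> num j \<preceq> num k"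
proof (induction k)
  case (Suc k)
  then show ?case using ord.order_trans[OF _ le_add(1)] by (auto simp: le_Suc_eq)
qed simp

lemma SRT2_sem:
  assumes cns: "\<And>e E. sat e E CNS" and "\<forall>i. E i \<in> S"
  shows "sat e E (SRT2 k)"
  unfolding SRT2_def sat.simps
proof (intro ballI impI)
  fix F assume F: "F \<in> S" and hyp: "sat e (F ## E) (is_fun in_N_2 (below k) 0 \<^bold>\<and> stable 0)"
  then have range: "\<And>p. p \<in> F \<Longrightarrow> \<exists>d c. (\<exists>x y. x \<prec> y \<and> d = pr x y) \<and> c \<prec> num k \<and> p = pr d c"
    and total: "\<And>x y. x \<prec> y \<Longrightarrow> \<exists>c. pr (pr x y) c \<in> F"
    and func: "\<And>d c c'. pr d c \<in> F \<Longrightarrow> pr d c' \<in> F \<Longrightarrow> c = c'"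
    and stab: "\<And>x. \<exists>v s0. \<forall>s. s0 \<preceq> s \<and> x \<prec> s \<longrightarrow> pr (pr x s) v \<in> F"
    by (auto simp: is_fun_def in_N_2_def below_def stable_def)
  \<comment> \<open>CNS expects a total function, while \<open>F\<close> colours increasing pairs
    only. The default at s <= x is invisible to the limit.\<close>
  define f where "f x s = (if x \<prec> s then THE c. pr (pr x s) c \<in> F else \<zero>)" for x s
  have f: "pr (pr x s) c \<in> F \<longleftrightarrow> c = f x s" if "x \<prec> s" for x s c
    using that total[OF that] func unfolding f_def by (auto intro: the_equality[symmetric] theI2)
  have "graph2 f \<in> S"
  proof (rule graph2_in_S[where e=e0 and E="F ## E0"])
    show "v = f x s \<longleftrightarrow> sat (v ## s ## x ## e0) (F ## E0)
      (Var 2 \<^bold>< Var 1 \<^bold>\<and> pair (pair (Var 2) (Var 1)) (Var 0) \<^bold>\<in> 0 \<^bold>\<or> \<^bold>\<not> (Var 2 \<^bold>< Var 1) \<^bold>\<and> Var 0 \<^bold>= Zero)" for x s v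
      by (cases "x \<prec> s") (simp_all add: f, simp_all add: f_def)
  qed (use F in \<open>auto intro!: Delta00_intros\<close>)
  moreover obtain l where l: "\<And>x. \<exists>s0. \<forall>s. s0 \<preceq> s \<and> x \<prec> s \<longrightarrow> pr (pr x s) (l x) \<in> F"
    using stab by metis
  have lim: "\<exists>s0. x \<prec> s0 \<and> (\<forall>s. s0 \<preceq> s \<longrightarrow> f x s = l x)" for x
  proof -
    obtain s0 where s0: "\<And>s. s0 \<preceq> s \<Longrightarrow> x \<prec> s \<Longrightarrow> pr (pr x s) (l x) \<in> F" using l by blast
    \<comment> \<open>Adding x + 1 to the threshold of stability also secures x < s, where
      \<open>f\<close> agrees with \<open>F\<close>.\<close>
    have "f x s = l x" if "s0 \<oplus> x \<oplus> \<one> \<preceq> s" for s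
    proof -
      have "s0 \<oplus> x \<prec> s" using that by (simp add: succ_le)
      then have "s0 \<preceq> s" "x \<prec> s"
        using le_add ord.le_less_trans ord.less_imp_le by blast+
      then show ?thesis using s0 f by metis
    qed
    moreover have "x \<prec> s0 \<oplus> x \<oplus> \<one>" by simp
    ultimately show ?thesis by blast
  qed
  have "converges f l" unfolding converges_def using lim by blast
  moreover have l_less: "l x \<prec> num k" for x
  proof -
    obtain s where "x \<prec> s" "f x s = l x" using lim by blast
    then have "pr (pr x s) (l x) \<in> F" using f by simp
    then show ?thesis using range by fastforce
  qed
  then have "l x \<preceq> num k" for x by (simp add: le_def)
  ultimately obtain X where X: "X \<in> S" "\<And>w. \<exists>x\<in>X. w \<preceq> x"
    and mono: "\<And>x y. x \<in> X \<Longrightarrow> y \<in> X \<Longrightarrow> x \<prec> y \<Longrightarrow> l x \<preceq> l y"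
    by (rule CNS_sem[OF cns]) blast
  \<comment> \<open>Consists of natural numbers of HOL, so its maximum exists without any
    definability of \<open>l\<close> in the model.\<close>
  define J where "J = {j. j < k \<and> (\<exists>x\<in>X. l x = num j)}"
  have "finite J" by (simp add: J_def)
  moreover have "J \<noteq> {}" using X(2) less_num[OF l_less] unfolding J_def by blast
  ultimately have max: "Max J \<in> J" "\<And>j. j \<in> J \<Longrightarrow> j \<le> Max J" by simp_all
  define i where "i = num (Max J)"
  obtain x0 where x0: "x0 \<in> X" "l x0 = i" using max(1) unfolding J_def i_def by blast
  define Y where "Y = {x \<in> X. x0 \<preceq> x}"
  have "Y \<in> S"
    by (rule delta_comprehension[where e="x0 ## e0" and E="X ## E0" and \<theta>="Var 0 \<^bold>\<in> 0 \<^bold>\<and> Var 1 \<^bold>\<le> Var 0"])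
      (use X in \<open>auto intro!: Delta00_intros simp: Y_def\<close>)
  have Y_inf: "\<exists>y\<in>Y. w \<preceq> y" for w
    using X(2)[of "w \<oplus> x0"] le_add ord.order_trans unfolding Y_def by blast
  \<comment> \<open>The choice of \<open>Max J\<close> bounds the limit colour from above,
    monotonicity from \<open>x0\<close> on bounds it from below.\<close>
  have lY: "l y = i" if "y \<in> Y" for y
  proof -
    obtain j where j: "j < k" "l y = num j" using less_num[OF l_less] by blast
    then have "j \<in> J" using that unfolding J_def Y_def by blast
    then have "l y \<preceq> i" using max(2) num_mono j unfolding i_def by simp
    moreover have "i \<preceq> l y"
      using that mono[of x0 y] x0 unfolding Y_def le_def[of x0] by auto
    ultimately show ?thesis by (rule ord.order.antisym)
  qed
  define B where "B = {pr x t | x t. x \<in> Y \<and> x \<prec> t \<and> pr (pr x t) i \<notin> F}"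
  have B: "pr x t \<in> B \<longleftrightarrow> x \<in> Y \<and> x \<prec> t \<and> pr (pr x t) i \<notin> F" for x t
    by (auto simp: B_def)
  have "B \<in> S"
  proof (rule delta_comprehension[where e="i ## e0" and E="Y ## F ## E0"])
    let ?\<phi> = "BEx (Var 0 \<^bold>+ One) (BEx (Var 1 \<^bold>+ One) (Var 2 \<^bold>= pair (Var 1) (Var 0) \<^bold>\<and> Var 1 \<^bold>\<in> 0 \<^bold>\<and>
        Var 1 \<^bold>< Var 0 \<^bold>\<and> \<^bold>\<not> (pair (Var 2) (Var 3) \<^bold>\<in> 1)))"
    show "p \<in> B \<longleftrightarrow> sat (p ## i ## e0) (Y ## F ## E0) ?\<phi>" for p
      by (auto simp: B_def)
    show "Delta00 ?\<phi>" by (intro Delta00_intros)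
  qed (use F \<open>Y \<in> S\<close> in auto)
  \<comment> \<open>A row of \<open>B\<close> is empty outside \<open>Y\<close>, and inside
    \<open>Y\<close> it is eventually empty because the limit colour there is
    \<open>i\<close>.\<close>
  have uniform: "\<exists>s. \<forall>x t. x \<prec> a \<longrightarrow> s \<preceq> t \<longrightarrow> pr x t \<notin> B" for a
  proof (rule collection[OF cns \<open>B \<in> S\<close>])
    fix x
    obtain s0 where "\<And>s. s0 \<preceq> s \<Longrightarrow> f x s = l x" using lim by blast
    then show "\<exists>s. \<forall>t. s \<preceq> t \<longrightarrow> pr x t \<notin> B" using B f lY by metis
  qed
  obtain H where "H \<in> S" and H: "\<And>x. x \<in> H \<longleftrightarrow> x \<in> Y \<and> (\<forall>z. z \<prec> x \<longrightarrow> z \<in> H \<longrightarrow> pr (pr z x) i \<in> F)"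
    using greedy_set[OF \<open>Y \<in> S\<close> F] by blast
  have inf: "\<exists>y\<in>H. w \<preceq> y" for w
  proof (rule ccontr)
    assume "\<not> ?thesis"
    then have below: "z \<prec> w" if "z \<in> H" for z using that by (auto simp: ord.not_le)
    \<comment> \<open>With \<open>H\<close> below \<open>w\<close>, any element of \<open>Y\<close>
      beyond both \<open>w\<close> and a common threshold for all x < w has colour \<open>i\<close>
      with all of \<open>H\<close>, so it would have been added.\<close>
    obtain s where s: "\<And>x t. x \<prec> w \<Longrightarrow> s \<preceq> t \<Longrightarrow> pr x t \<notin> B" using uniform by blast
    obtain y where y: "y \<in> Y" "s \<oplus> w \<preceq> y" using Y_inf by blast
    then have "s \<preceq> y" "w \<preceq> y" using le_add ord.order_trans by blast+
    have "pr (pr z y) i \<in> F" if "z \<prec> y" "z \<in> H" for z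
      using s[of z y] below[OF that(2)] \<open>s \<preceq> y\<close> that H[of z] B by blast
    then have "y \<in> H" using H y by blast
    then show False using below \<open>w \<preceq> y\<close> by (auto simp: ord.not_le[symmetric])
  qed
  have "sat e (H ## F ## E) (infinite_set 0)" using inf by (auto simp: infinite_set_def)
  moreover have "sat e (H ## F ## E) (homogeneous 1 0)"
  proof -
    have "\<forall>x y. x \<in> H \<and> y \<in> H \<and> x \<prec> y \<longrightarrow> pr (pr x y) i \<in> F" using H by blast
    then show ?thesis by (auto simp: homogeneous_def)
  qed
  ultimately show "sat e (F ## E) (Ex2 (infinite_set 0 \<^bold>\<and> homogeneous 1 0))"
    unfolding sat_connectives using \<open>H \<in> S\<close> by blast
qed

end

section \<open>From models back to provability\<close>

lemma RCA0_closed: "\<phi> \<in> RCA0 \<Longrightarrow> closed 0 0 \<phi>"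
proof -
  have 2: "closed i 0 ((All2 ^^ j) \<psi>)" if "closed i j \<psi>" for i j \<psi>
    using that by (induction j arbitrary: \<psi>) (simp_all add: funpow_swap1)
  have 1: "closed 0 0 ((All1 ^^ i) \<psi>)" if "closed i 0 \<psi>" for i \<psi>
    using that by (induction i arbitrary: \<psi>) (simp_all add: funpow_swap1)
  show "\<phi> \<in> RCA0 \<Longrightarrow> closed 0 0 \<phi>" unfolding RCA0_def closures_def using 1 2 by blast
qed

lemmas formula_defs = Neg_def And_def Or_def Iff_def Ex1_def Ex2_def Le_def is_fun_def in_N_def
  in_NxN_def in_N_2_def below_def infinite_set_def lim_eq_def limits_exist_def limits_bounded_by_def
  limits_nondecreasing_on_def stable_def homogeneous_def pair_def

lemma CNS_closed: "closed 0 0 CNS"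
  unfolding CNS_def formula_defs by simp

lemma SRT2_closed: "closed 0 0 (SRT2 k)"
proof -
  have "closed_tm m (numeral_tm k)" for m by (induction k) simp_all
  then show ?thesis unfolding SRT2_def formula_defs by simp
qed

theorem mainTheorem3:
  fixes k :: nat
  shows "RCA0 \<union> {CNS} \<turnstile> SRT2 k"
proof (rule ccontr)
  let ?\<Gamma> = "insert (\<^bold>\<not> SRT2 k) (RCA0 \<union> {CNS})"
  assume "\<not> (RCA0 \<union> {CNS} \<turnstile> SRT2 k)"
  then have "consistent ?\<Gamma>" using Classical unfolding consistent_def by blast
  moreover have "\<forall>\<psi>\<in>?\<Gamma>. closed 0 0 \<psi>"
    using RCA0_closed CNS_closed SRT2_closed by (auto simp: Neg_def)
  ultimately obtain T where T: "henkin T" "?\<Gamma> \<subseteq> T" using henkin_extension by blast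
  interpret henkin_theory T using T(1) by unfold_locales
  have "\<And>m n. (numeral_tm m \<^bold>= numeral_tm n) \<in> T \<Longrightarrow> m = n" using numeral_tm_inj T by blast
  then obtain zero one :: nat and add mul less S e E where E: "\<forall>i. E i \<in> S"
    and model: "\<forall>\<phi>\<in>T. L2_structure.sat zero one add mul less S e E \<phi>"
    by (rule model_exists)
  interpret L2_structure zero one add mul less S .
  interpret rca0_model zero one add mul less S
  proof
    show "S \<noteq> {}" using E by blast
    show "sat e' E' \<phi>" if "\<phi> \<in> basic_axioms \<union> {induction_axiom \<phi> | \<phi>. Sigma01 \<phi>}
      \<union> {comprehension_axiom \<phi> \<psi> | \<phi> \<psi>. Sigma01 \<phi> \<and> Pi01 \<psi>}" "\<forall>i. E' i \<in> S" for \<phi> e' E'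
      by (rule sat_closures[OF _ that, of e E]) (use model T in \<open>auto simp: RCA0_def\<close>)
  qed
  have "sat e E CNS" using model T by blast
  then have "sat e' E' CNS" for e' E' using sat_cong_closed[OF CNS_closed, of e e' E E'] by simp
  then have "sat e E (SRT2 k)" using E by (rule SRT2_sem)
  moreover have "sat e E (\<^bold>\<not> SRT2 k)" using model T by blast
  ultimately show False by simp
qed

end
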